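(* Let $P$ be a finite interval order. A cycle inequality of the key graph $G_P$ is redundant if and only if it is a non-negative integral linear combination of cycle inequalities that are smaller than it in the weak order.
   Context: A finite partial order $P=([n],\prec)$ is an interval order if there are compact real intervals $I_x=[\ell_x,r_x]$ with $x\prec y$ iff $r_x<\ell_y$; write $x\parallel y$ if $x\ne y$ are incomparable. The canonical representation $[\ell_x,r_x]_{x\in[n]}$ of $P$ is the (unique) representation using the minimum number $m$ of distinct endpoints, placed at $0,\dots,m-1$. For $y\not\prec x$, the slack of $(x,y)$ there is $\ell_y-r_x-1$ if $x\prec y$, $r_y-\ell_x$ if $x\parallel y$, $r_x-\ell_x$ if $x=y$; slack-$0$ pairs are slack zero pairs, called cover pairs if $x\prec y$ and sharp pairs if $x\parallel y$. The key graph $G_P$ has vertex set $\{\rho_1,\dots,\rho_n\}$ and colored, weighted arcs (weights being linear inequalities in $\ell_1,\dots,\ell_n,\rho_1,\dots,\rho_n$): a blue arc $\rho_x\to\rho_y$ of weight $\langle\ell_x+\rho_x+1\le\ell_y\rangle$ for each slack zero cover pair; a red arc $\rho_x\to\rho_y$ of weight $\langle\ell_x\le\ell_y+\rho_y\rangle$ for each slack zero sharp pair; a red loop at $\rho_x$ of weight $\langle-\rho_x\le0\rangle$ for each slack zero pair $(x,x)$. For a directed cycle $C$ (loops included), the termwise sum of its arc weights (with cancellation) is its cycle inequality $\langle\gamma+\sum_{i\in A}\rho_i\le\sum_{j\in B}\rho_j\rangle$, where $\gamma$ is the number of blue arcs of $C$ and, for consecutive arcs $\rho_x\to\rho_y\to\rho_z$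 of $C$, $y\in A$ if both are blue and $y\in B$ if both are red ($A\cap B=\emptyset$). Inequalities are equivalent if they coincide after simplification. A cycle inequality $W$ is redundant if $W=\sum_i\alpha_iW_i$ for finitely many cycle inequalities $W_i$ not equivalent to $W$ and rational $\alpha_i\ge0$. The weak order on cycle inequalities: $\langle\gamma_1+\sum_{A_1}\rho_i\le\sum_{B_1}\rho_j\rangle$ is smaller than $\langle\gamma_2+\sum_{A_2}\rho_i\le\sum_{B_2}\rho_j\rangle$ iff $\gamma_1<\gamma_2$, or ($\gamma_1=\gamma_2$ and $|A_2|<|A_1|$), or ($\gamma_1=\gamma_2$, $|A_1|=|A_2|$ and $|B_1|<|B_2|$). *)

theory Defs
  imports Complex_Main "Graph_Theory.Arc_Walk"
begin

section \<open>Interval orders and their canonical representation\<close>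

text \<open>
  An order on \<open>[n]\<close> is given by \<open>n\<close> and a predicate \<open>prec\<close>, of which only the restriction to
  \<open>{1..n}\<close> matters. Representations are given by the functions of left and right endpoints.
\<close>

definition interval_rep ::
    "nat \<Rightarrow> (nat \<Rightarrow> nat \<Rightarrow> bool) \<Rightarrow> (nat \<Rightarrow> real) \<Rightarrow> (nat \<Rightarrow> real) \<Rightarrow> bool" where
  "interval_rep n prec l r \<longleftrightarrow>
     (\<forall>x\<in>{1..n}. l x \<le> r x) \<and> (\<forall>x\<in>{1..n}. \<forall>y\<in>{1..n}. prec x y \<longleftrightarrow> r x < l y)"

definition interval_order :: "nat \<Rightarrow> (nat \<Rightarrow> nat \<Rightarrow> bool) \<Rightarrow> bool" where
  "interval_order n prec \<longleftrightarrow>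
     irreflp_on {1..n} prec \<and> transp_on {1..n} prec \<and> (\<exists>l r. interval_rep n prec l r)"

definition incomparable :: "(nat \<Rightarrow> nat \<Rightarrow> bool) \<Rightarrow> nat \<Rightarrow> nat \<Rightarrow> bool" where
  "incomparable prec x y \<longleftrightarrow> x \<noteq> y \<and> \<not> prec x y \<and> \<not> prec y x"

definition endpoints :: "nat \<Rightarrow> (nat \<Rightarrow> real) \<Rightarrow> (nat \<Rightarrow> real) \<Rightarrow> real set" where
  "endpoints n l r = l ` {1..n} \<union> r ` {1..n}"

definition canonical_rep ::
    "nat \<Rightarrow> (nat \<Rightarrow> nat \<Rightarrow> bool) \<Rightarrow> (nat \<Rightarrow> real) \<Rightarrow> (nat \<Rightarrow> real) \<Rightarrow> bool" where
  "canonical_rep n prec l r \<longleftrightarrow>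
     interval_rep n prec l r \<and>
     (\<forall>l' r'. interval_rep n prec l' r' \<longrightarrow> card (endpoints n l r) \<le> card (endpoints n l' r')) \<and>
     endpoints n l r = real ` {..<card (endpoints n l r)}"

text \<open>
  The choice below only affects the values outside \<open>{1..n}\<close>: existence and uniqueness on
  \<open>{1..n}\<close> are the lemmas \<open>canonical_rep_canon\<close> and \<open>canonical_rep_unique\<close>.
\<close>

definition canon :: "nat \<Rightarrow> (nat \<Rightarrow> nat \<Rightarrow> bool) \<Rightarrow> (nat \<Rightarrow> real) \<times> (nat \<Rightarrow> real)" where
  "canon n prec = (SOME (l, r). canonical_rep n prec l r)"

abbreviation canon_l :: "nat \<Rightarrow> (nat \<Rightarrow> nat \<Rightarrow> bool) \<Rightarrow> nat \<Rightarrow> real" where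
  "canon_l n prec \<equiv> fst (canon n prec)"

abbreviation canon_r :: "nat \<Rightarrow> (nat \<Rightarrow> nat \<Rightarrow> bool) \<Rightarrow> nat \<Rightarrow> real" where
  "canon_r n prec \<equiv> snd (canon n prec)"

lemma finite_endpoints: "finite (endpoints n l r)"
  by (simp add: endpoints_def)

lemma interval_rep_mono:
  assumes rep: "interval_rep n prec l r"
    and mono: "\<And>a b. a \<in> endpoints n l r \<Longrightarrow> b \<in> endpoints n l r \<Longrightarrow> a \<le> b \<Longrightarrow> f a \<le> f b"
    and strict: "\<And>x y. x \<in> {1..n} \<Longrightarrow> y \<in> {1..n} \<Longrightarrow> r x < l y \<Longrightarrow> f (r x) < f (l y)"
  shows "interval_rep n prec (\<lambda>x. f (l x)) (\<lambda>x. f (r x))"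
proof -
  have e: "l x \<in> endpoints n l r" "r x \<in> endpoints n l r" if "x \<in> {1..n}" for x
    using that unfolding endpoints_def by blast+
  show ?thesis
    unfolding interval_rep_def
  proof (intro conjI ballI)
    fix x assume x: "x \<in> {1..n}"
    then have "l x \<le> r x" using rep unfolding interval_rep_def by blast
    then show "f (l x) \<le> f (r x)" using mono e x by blast
  next
    fix x y assume x: "x \<in> {1..n}" and y: "y \<in> {1..n}"
    have "prec x y \<longleftrightarrow> r x < l y" using rep x y unfolding interval_rep_def by blast
    moreover have "r x < l y \<longleftrightarrow> f (r x) < f (l y)"
    proof
      assume "f (r x) < f (l y)"
      then show "r x < l y" using mono[OF e(1)[OF y] e(2)[OF x]] by linarith
    qed (rule strict[OF x y])
    ultimately show "prec x y \<longleftrightarrow> f (r x) < f (l y)" by blast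
  qed
qed

lemma endpoints_image: "endpoints n (\<lambda>x. f (l x)) (\<lambda>x. f (r x)) = f ` endpoints n l r"
  unfolding endpoints_def by (simp add: image_Un image_image)

lemma canonical_rep_exists:
  assumes "\<exists>l r. interval_rep n prec l r"
  shows "\<exists>l r. canonical_rep n prec l r"
proof -
  define Q where "Q = (\<lambda>k. \<exists>l r. interval_rep n prec l r \<and> card (endpoints n l r) = k)"
  have "\<exists>k. Q k" using assms unfolding Q_def by blast
  then have "Q (LEAST k. Q k)" by (rule LeastI_ex)
  then obtain l r where rep: "interval_rep n prec l r"
    and least: "card (endpoints n l r) = (LEAST k. Q k)" unfolding Q_def by blast
  let ?E = "endpoints n l r"
  define f where "f = (\<lambda>a::real. real (card {e \<in> ?E. e < a}))"
  have mono: "f a \<le> f b" if "a \<le> b" for a b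
    unfolding f_def using that finite_endpoints[of n l r] by (auto intro!: card_mono)
  have strict: "f a < f b" if "a \<in> ?E" "a < b" for a b
    unfolding f_def of_nat_less_iff using that finite_endpoints[of n l r]
    by (intro psubset_card_mono) auto
  have le: "r x \<in> ?E" if "x \<in> {1..n}" for x using that unfolding endpoints_def by blast
  have rep': "interval_rep n prec (\<lambda>x. f (l x)) (\<lambda>x. f (r x))"
  proof (rule interval_rep_mono[where f = f, OF rep])
    show "f a \<le> f b" if "a \<le> b" for a b using that by (rule mono)
    show "f (r x) < f (l y)" if "x \<in> {1..n}" "r x < l y" for x y
      using le[OF that(1)] that(2) by (rule strict)
  qed
  have inj: "inj_on f ?E"
  proof (rule inj_onI)
    fix a b assume "a \<in> ?E" "b \<in> ?E" "f a = f b"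
    then show "a = b" using strict[of a b] strict[of b a] by linarith
  qed
  have card: "card (f ` ?E) = card ?E" using inj by (rule card_image)
  have "f ` ?E \<subseteq> real ` {..<card ?E}"
  proof
    fix z assume "z \<in> f ` ?E"
    then obtain a where a: "a \<in> ?E" "z = f a" by blast
    have "card {e \<in> ?E. e < a} < card ?E"
      using a finite_endpoints[of n l r] by (intro psubset_card_mono) auto
    then show "z \<in> real ` {..<card ?E}" using a unfolding f_def by auto
  qed
  then have img: "f ` ?E = real ` {..<card ?E}"
    by (intro card_subset_eq) (auto simp: card card_image inj_on_def)
  have "canonical_rep n prec (\<lambda>x. f (l x)) (\<lambda>x. f (r x))"
    unfolding canonical_rep_def endpoints_image card
  proof (intro conjI allI impI rep' img)
    fix l' r' assume "interval_rep n prec l' r'"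
    then have "Q (card (endpoints n l' r'))" unfolding Q_def by blast
    then show "card ?E \<le> card (endpoints n l' r')" unfolding least by (rule Least_le)
  qed
  then show ?thesis by blast
qed

lemma canonical_rep_canon:
  assumes "interval_order n prec"
  shows "canonical_rep n prec (canon_l n prec) (canon_r n prec)"
proof -
  have "\<exists>p. case p of (l, r) \<Rightarrow> canonical_rep n prec l r"
    using canonical_rep_exists assms unfolding interval_order_def by auto
  then have "case canon n prec of (l, r) \<Rightarrow> canonical_rep n prec l r"
    unfolding canon_def by (rule someI_ex)
  then show ?thesis by (simp add: case_prod_beta)
qed

text \<open>In the canonical representation every endpoint is both a left and a right endpoint.\<close>

lemma canonical_rep_not_mergeable:
  assumes can: "canonical_rep n prec l r"
    and ab: "a \<in> endpoints n l r" "b \<in> endpoints n l r" "a < b"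
    and adj: "\<And>e. e \<in> endpoints n l r \<Longrightarrow> e \<le> a \<or> b \<le> e"
  shows "\<exists>x\<in>{1..n}. r x = a" "\<exists>y\<in>{1..n}. l y = b"
proof -
  let ?E = "endpoints n l r"
  define f where "f = (\<lambda>e. if e = b then a else e)"
  have "\<exists>x\<in>{1..n}. \<exists>y\<in>{1..n}. r x < l y \<and> \<not> f (r x) < f (l y)"
  proof (rule ccontr)
    assume neg: "\<not> ?thesis"
    have rep: "interval_rep n prec l r" using can unfolding canonical_rep_def by blast
    have mono: "f c \<le> f d" if "c \<in> ?E" "d \<in> ?E" "c \<le> d" for c d
      using that ab adj[of c] adj[of d] unfolding f_def by auto
    have "interval_rep n prec (\<lambda>x. f (l x)) (\<lambda>x. f (r x))"
    proof (rule interval_rep_mono[where f = f, OF rep])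
      show "f c \<le> f d" if "c \<in> ?E" "d \<in> ?E" "c \<le> d" for c d using that by (rule mono)
      show "f (r x) < f (l y)" if "x \<in> {1..n}" "y \<in> {1..n}" "r x < l y" for x y
        using neg that by blast
    qed
    then have "card ?E \<le> card (f ` ?E)"
      using can unfolding canonical_rep_def endpoints_image[symmetric] by blast
    moreover have "f ` ?E \<subseteq> ?E - {b}" using ab unfolding f_def by auto
    then have "card (f ` ?E) \<le> card (?E - {b})"
      using finite_endpoints[of n l r] by (intro card_mono) auto
    moreover have "card (?E - {b}) < card ?E"
      using ab finite_endpoints[of n l r] by (intro psubset_card_mono) auto
    ultimately show False by linarith
  qed
  then obtain x y where xy: "x \<in> {1..n}" "y \<in> {1..n}" "r x < l y" "\<not> f (r x) < f (l y)"
    by blast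
  have "r x \<in> ?E" "l y \<in> ?E" using xy unfolding endpoints_def by blast+
  then have "l y = b \<and> r x = a"
    using xy(3,4) ab(3) adj[of "r x"] unfolding f_def by (auto split: if_splits)
  then show "\<exists>x\<in>{1..n}. r x = a" "\<exists>y\<in>{1..n}. l y = b" using xy by blast+
qed

lemma canonical_rep_endpoints:
  assumes can: "canonical_rep n prec l r"
  shows "l ` {1..n} = real ` {..<card (endpoints n l r)}"
    and "r ` {1..n} = real ` {..<card (endpoints n l r)}"
proof -
  define m where "m = card (endpoints n l r)"
  have E: "endpoints n l r = real ` {..<m}"
    using can unfolding canonical_rep_def m_def by blast
  have lr: "l x \<le> r x" if "x \<in> {1..n}" for x
    using can that unfolding canonical_rep_def interval_rep_def by blast
  have step: "(\<exists>x\<in>{1..n}. r x = real k) \<and> (\<exists>y\<in>{1..n}. l y = real (Suc k))"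
    if "Suc k < m" for k
  proof -
    have "real k \<in> endpoints n l r" "real (Suc k) \<in> endpoints n l r"
      unfolding E by (rule imageI, use that in simp)+
    moreover have "e \<le> real k \<or> real (Suc k) \<le> e" if e: "e \<in> endpoints n l r" for e
    proof -
      obtain i where i: "e = real i" using e unfolding E by blast
      show ?thesis unfolding i of_nat_le_iff by linarith
    qed
    ultimately show ?thesis
      using canonical_rep_not_mergeable[OF can, of "real k" "real (Suc k)"] by auto
  qed
  have L: "real k \<in> l ` {1..n}" if k: "k < m" for k
  proof (cases k)
    case 0
    have "real 0 \<in> endpoints n l r" using k 0 by (simp add: E)
    then consider "real 0 \<in> l ` {1..n}" | x where "x \<in> {1..n}" "r x = real 0"
      unfolding endpoints_def by auto
    then show ?thesis
    proof cases
      case 2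
      have "l x \<in> endpoints n l r" using 2 unfolding endpoints_def by blast
      then have "l x \<ge> 0" unfolding E by auto
      then have "real k = l x" using lr[of x] 2 0 by simp
      then show ?thesis using 2 by blast
    qed (use 0 in simp)
  next
    case (Suc j)
    then obtain y where y: "y \<in> {1..n}" "l y = real k" using step[of j] k by blast
    show ?thesis using imageI[OF y(1), of l] unfolding y(2) .
  qed
  have R: "real k \<in> r ` {1..n}" if k: "k < m" for k
  proof (cases "Suc k < m")
    case True
    then obtain x where x: "x \<in> {1..n}" "r x = real k" using step[of k] by blast
    show ?thesis using imageI[OF x(1), of r] unfolding x(2) .
  next
    case False
    have "real k \<in> endpoints n l r" using k by (simp add: E)
    then consider "real k \<in> r ` {1..n}" | x where "x \<in> {1..n}" "l x = real k"
      unfolding endpoints_def by auto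
    then show ?thesis
    proof cases
      case 2
      have "r x \<in> endpoints n l r" using 2 unfolding endpoints_def by blast
      then obtain i where "r x = real i" "i < m" unfolding E by blast
      then have "real k = r x" using lr[of x] 2 False by simp
      then show ?thesis using 2 by blast
    qed simp
  qed
  show "l ` {1..n} = real ` {..<card (endpoints n l r)}"
    unfolding m_def[symmetric]
  proof (rule subset_antisym)
    show "l ` {1..n} \<subseteq> real ` {..<m}"
      unfolding E[symmetric] endpoints_def by (rule Un_upper1)
    show "real ` {..<m} \<subseteq> l ` {1..n}"
      by (rule image_subsetI, rule L) simp
  qed
  show "r ` {1..n} = real ` {..<card (endpoints n l r)}"
    unfolding m_def[symmetric]
  proof (rule subset_antisym)
    show "r ` {1..n} \<subseteq> real ` {..<m}"
      unfolding E[symmetric] endpoints_def by (rule Un_upper2)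
    show "real ` {..<m} \<subseteq> r ` {1..n}"
      by (rule image_subsetI, rule R) simp
  qed
qed

lemma canonical_rep_formula:
  assumes can: "canonical_rep n prec l r"
  defines "D \<equiv> \<lambda>y. {x \<in> {1..n}. prec x y}"
  assumes z: "z \<in> {1..n}"
  shows "l z = real (card (D ` {y \<in> {1..n}. D y \<subset> D z}))"
    and "r z = real (card (D ` {y \<in> {1..n}. \<not> prec z y})) - 1"
proof -
  let ?m = "card (endpoints n l r)"
  have L: "l ` {1..n} = real ` {..<?m}" and R: "r ` {1..n} = real ` {..<?m}"
    using canonical_rep_endpoints[OF can] by blast+
  have prec: "prec x y \<longleftrightarrow> r x < l y" if "x \<in> {1..n}" "y \<in> {1..n}" for x y
    using can that unfolding canonical_rep_def interval_rep_def by blast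
  have D: "D y = {x \<in> {1..n}. r x < l y}" if "y \<in> {1..n}" for y
    using prec that unfolding D_def by blast
  have sub: "l y < l y' \<longleftrightarrow> D y \<subset> D y'" if y: "y \<in> {1..n}" and y': "y' \<in> {1..n}" for y y'
  proof
    assume less: "l y < l y'"
    obtain x where x: "x \<in> {1..n}" "r x = l y" using y L R by (metis image_iff)
    then have "x \<in> D y'" "x \<notin> D y" using less y y' D by auto
    moreover have "D y \<subseteq> D y'" using less y y' D by auto
    ultimately show "D y \<subset> D y'" by blast
  next
    assume ps: "D y \<subset> D y'"
    show "l y < l y'"
    proof (rule ccontr)
      assume "\<not> l y < l y'"
      then have "D y' \<subseteq> D y" using y y' D by auto
      then show False using ps by blast
    qed
  qed
  have eq: "l y = l y' \<longleftrightarrow> D y = D y'" if y: "y \<in> {1..n}" and y': "y' \<in> {1..n}" for y y'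
    using sub[OF y y'] sub[OF y' y] D[OF y] D[OF y']
    by (metis linorder_neqE_linordered_idom psubsetE order_less_irrefl)
  have cards: "card (D ` S) = card (l ` S)" if S: "S \<subseteq> {1..n}" for S
  proof -
    define g where "g = (\<lambda>v. D (SOME y. y \<in> S \<and> l y = v))"
    have g: "g (l y) = D y" if "y \<in> S" for y
    proof -
      have "(SOME y'. y' \<in> S \<and> l y' = l y) \<in> S \<and> l (SOME y'. y' \<in> S \<and> l y' = l y) = l y"
        by (rule someI[of _ y]) (use that in simp)
      then show ?thesis unfolding g_def using eq S that by blast
    qed
    have "D ` S = g ` l ` S" using g by (force simp: image_iff)
    moreover have "inj_on g (l ` S)"
    proof (rule inj_onI)
      fix v w assume "v \<in> l ` S" "w \<in> l ` S" and gvw: "g v = g w"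
      then obtain y y' where y: "y \<in> S" "v = l y" "y' \<in> S" "w = l y'" by blast
      then have "D y = D y'" using g gvw by simp
      then show "v = w" using eq[of y y'] y S by blast
    qed
    ultimately show ?thesis by (simp add: card_image)
  qed
  have "l z \<in> real ` {..<?m}" "r z \<in> real ` {..<?m}" using z L R by blast+
  then obtain i j where i: "l z = real i" "i < ?m" and j: "r z = real j" "j < ?m" by blast
  have img: "l ` {y \<in> {1..n}. Q (l y)} = {v \<in> l ` {1..n}. Q v}" for Q
    by blast
  have "{y \<in> {1..n}. D y \<subset> D z} = {y \<in> {1..n}. l y < l z}"
    using sub z by (intro Collect_cong conj_cong) simp_all
  then have "l ` {y \<in> {1..n}. D y \<subset> D z} = {v \<in> l ` {1..n}. v < l z}"
    using img by (rule ssubst)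
  also have "\<dots> = real ` {..<i}" unfolding L i using i(2) by auto
  finally show "l z = real (card (D ` {y \<in> {1..n}. D y \<subset> D z}))"
    by (subst cards) (auto simp: i card_image inj_on_def)
  have "{y \<in> {1..n}. \<not> prec z y} = {y \<in> {1..n}. l y \<le> r z}"
    using prec z by (intro Collect_cong conj_cong) (simp_all add: not_less)
  then have "l ` {y \<in> {1..n}. \<not> prec z y} = {v \<in> l ` {1..n}. v \<le> r z}"
    using img by (rule ssubst)
  also have "\<dots> = real ` {..j}" unfolding L j using j(2) by auto
  finally show "r z = real (card (D ` {y \<in> {1..n}. \<not> prec z y})) - 1"
    by (subst cards) (auto simp: j card_image inj_on_def)
qed

lemma canonical_rep_unique:
  assumes "canonical_rep n prec l r" "canonical_rep n prec l' r'" "x \<in> {1..n}"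
  shows "l x = l' x" "r x = r' x"
  using canonical_rep_formula[OF assms(1,3)] canonical_rep_formula[OF assms(2,3)] by auto

section \<open>Slack and the key graph\<close>

text \<open>The slack of \<open>(x, y)\<close> is only meaningful if \<open>\<not> prec y x\<close>.\<close>

definition slack :: "nat \<Rightarrow> (nat \<Rightarrow> nat \<Rightarrow> bool) \<Rightarrow> nat \<Rightarrow> nat \<Rightarrow> real" where
  "slack n prec x y =
     (if prec x y then canon_l n prec y - canon_r n prec x - 1
      else if incomparable prec x y then canon_r n prec y - canon_l n prec x
      else canon_r n prec x - canon_l n prec x)"

definition slack_zero :: "nat \<Rightarrow> (nat \<Rightarrow> nat \<Rightarrow> bool) \<Rightarrow> nat \<Rightarrow> nat \<Rightarrow> bool" where
  "slack_zero n prec x y \<longleftrightarrow>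
     x \<in> {1..n} \<and> y \<in> {1..n} \<and> \<not> prec y x \<and> slack n prec x y = 0"

datatype color = Blue | Red

text \<open>
  The vertex \<open>\<rho>\<^sub>x\<close> is represented by \<open>x\<close>, an arc by the triple of its tail, color and head.
\<close>

definition key_graph :: "nat \<Rightarrow> (nat \<Rightarrow> nat \<Rightarrow> bool) \<Rightarrow> (nat, nat \<times> color \<times> nat) pre_digraph" where
  "key_graph n prec =
     \<lparr> verts = {1..n},
       arcs = {(x, Blue, y) | x y. slack_zero n prec x y \<and> prec x y}
            \<union> {(x, Red, y) | x y. slack_zero n prec x y \<and> incomparable prec x y}
            \<union> {(x, Red, x) | x. slack_zero n prec x x},
       tail = (\<lambda>(x, c, y). x),
       head = (\<lambda>(x, c, y). y) \<rparr>"

section \<open>Linear inequalities\<close>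

text \<open>
  A linear inequality is represented by its simplified form with all terms collected on the
  left: \<open>W :: lin_ineq\<close> stands for \<open>\<langle>W Unit + (\<Sum>x. W (Ell x) \<ell>\<^sub>x) + (\<Sum>x. W (Rho x) \<rho>\<^sub>x) \<le> 0\<rangle>\<close>.
  Hence equivalence of inequalities is equality, and linear combinations are pointwise.
\<close>

datatype monom = Unit | Ell nat | Rho nat

type_synonym lin_ineq = "monom \<Rightarrow> rat"

abbreviation term1 :: "monom \<Rightarrow> lin_ineq" where
  "term1 s \<equiv> (\<lambda>t. of_bool (t = s))"

text \<open>
  Blue arcs: \<open>\<langle>\<ell>\<^sub>x + \<rho>\<^sub>x + 1 \<le> \<ell>\<^sub>y\<rangle>\<close>. Red arcs: \<open>\<langle>\<ell>\<^sub>x \<le> \<ell>\<^sub>y + \<rho>\<^sub>y\<rangle>\<close>, which for a loop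
  (\<open>x = y\<close>) is \<open>\<langle>-\<rho>\<^sub>x \<le> 0\<rangle>\<close>.
\<close>

fun arc_weight :: "nat \<times> color \<times> nat \<Rightarrow> lin_ineq" where
  "arc_weight (x, Blue, y) =
     (\<lambda>t. term1 (Ell x) t + term1 (Rho x) t + term1 Unit t - term1 (Ell y) t)"
| "arc_weight (x, Red, y) =
     (\<lambda>t. term1 (Ell x) t - (term1 (Ell y) t + term1 (Rho y) t))"

definition cycle_ineq :: "(nat \<times> color \<times> nat) list \<Rightarrow> lin_ineq" where
  "cycle_ineq C = (\<lambda>t. \<Sum>a\<leftarrow>C. arc_weight a t)"

text \<open>\<^const>\<open>pre_digraph.cycle\<close> means cycles without repeated vertices, including loops.\<close>

definition cycle_ineqs :: "nat \<Rightarrow> (nat \<Rightarrow> nat \<Rightarrow> bool) \<Rightarrow> lin_ineq set" where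
  "cycle_ineqs n prec = cycle_ineq ` {C. pre_digraph.cycle (key_graph n prec) C}"

text \<open>
  The data \<open>\<gamma>\<close>, \<open>A\<close>, \<open>B\<close> of a cycle inequality \<open>\<langle>\<gamma> + (\<Sum>i\<in>A. \<rho>\<^sub>i) \<le> (\<Sum>j\<in>B. \<rho>\<^sub>j)\<rangle>\<close>. That cycle
  inequalities have this form, and the description of \<open>\<gamma>\<close>, \<open>A\<close>, \<open>B\<close> in terms of the arcs of
  the cycle, are the lemmas \<open>cycle_ineq_form\<close> and \<open>cycle_ineq_data\<close>.
\<close>

definition ineq_gamma :: "lin_ineq \<Rightarrow> rat" where
  "ineq_gamma W = W Unit"

definition ineq_A :: "lin_ineq \<Rightarrow> nat set" where
  "ineq_A W = {i. W (Rho i) > 0}"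

definition ineq_B :: "lin_ineq \<Rightarrow> nat set" where
  "ineq_B W = {i. W (Rho i) < 0}"

definition smaller :: "lin_ineq \<Rightarrow> lin_ineq \<Rightarrow> bool" where
  "smaller W1 W2 \<longleftrightarrow>
     ineq_gamma W1 < ineq_gamma W2 \<or>
     ineq_gamma W1 = ineq_gamma W2 \<and> card (ineq_A W2) < card (ineq_A W1) \<or>
     ineq_gamma W1 = ineq_gamma W2 \<and> card (ineq_A W1) = card (ineq_A W2) \<and>
       card (ineq_B W1) < card (ineq_B W2)"

definition redundant :: "nat \<Rightarrow> (nat \<Rightarrow> nat \<Rightarrow> bool) \<Rightarrow> lin_ineq \<Rightarrow> bool" where
  "redundant n prec W \<longleftrightarrow>
     (\<exists>S \<alpha>. finite S \<and> S \<subseteq> {V \<in> cycle_ineqs n prec. V \<noteq> W} \<and>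
            (\<forall>V\<in>S. (\<alpha> V :: rat) \<ge> 0) \<and> W = (\<lambda>t. \<Sum>V\<in>S. \<alpha> V * V t))"

subsection \<open>Cycle inequalities in terms of arcs\<close>

text \<open>
  \<open>mono_verts c C\<close> consists of the vertices \<open>y\<close> where consecutive arcs \<open>\<rho>\<^sub>x \<rightarrow> \<rho>\<^sub>y \<rightarrow> \<rho>\<^sub>z\<close> of \<open>C\<close> (the last
  arc being followed by the first, so a loop follows itself) both have color \<open>c\<close>.
\<close>

abbreviation arc_color :: "nat \<times> color \<times> nat \<Rightarrow> color" where
  "arc_color a \<equiv> fst (snd a)"

definition consecutive :: "'a list \<Rightarrow> ('a \<times> 'a) set" where
  "consecutive C = set (zip C (rotate1 C))"

definition mono_verts :: "color \<Rightarrow> (nat \<times> color \<times> nat) list \<Rightarrow> nat set" where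
  "mono_verts c C = {snd (snd a) | a b. (a, b) \<in> consecutive C \<and> arc_color a = c \<and> arc_color b = c}"

lemma key_graph_simps:
  "verts (key_graph n prec) = {1..n}"
  "tail (key_graph n prec) a = fst a"
  "head (key_graph n prec) a = snd (snd a)"
  by (auto simp: key_graph_def split: prod.splits)

lemma key_graph_cas:
  assumes "pre_digraph.cas (key_graph n prec) u C v"
  shows "map fst C @ [v] = u # map (\<lambda>a. snd (snd a)) C"
  using assms
proof (induction C arbitrary: u)
  case Nil
  then show ?case by (simp add: pre_digraph.cas.simps)
next
  case (Cons a C)
  then show ?case by (simp add: pre_digraph.cas.simps key_graph_simps)
qed

lemma key_graph_cycle:
  assumes "pre_digraph.cycle (key_graph n prec) C"
  shows "C \<noteq> []" "distinct (map (\<lambda>a. snd (snd a)) C)"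
    "map fst (rotate1 C) = map (\<lambda>a. snd (snd a)) C"
proof -
  obtain u where cas: "pre_digraph.cas (key_graph n prec) u C u"
    and dist: "distinct (tl (pre_digraph.awalk_verts (key_graph n prec) u C))"
    and ne: "C \<noteq> []"
    using assms by (auto simp: pre_digraph.cycle_def pre_digraph.awalk_def)
  show "C \<noteq> []" by (rule ne)
  have "head (key_graph n prec) = (\<lambda>a. snd (snd a))" by (rule ext) (rule key_graph_simps)
  then show "distinct (map (\<lambda>a. snd (snd a)) C)"
    using dist ne by (simp add: pre_digraph.awalk_verts_conv'[OF cas])
  show "map fst (rotate1 C) = map (\<lambda>a. snd (snd a)) C"
    using key_graph_cas[OF cas] ne by (cases C) auto
qed

lemma sum_list_map_rotate1: "(\<Sum>a\<leftarrow>rotate1 C. f a) = (\<Sum>a\<leftarrow>C. f a :: 'b :: comm_monoid_add)"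
  by (cases C) (simp_all add: add.commute)

lemma sum_list_distinct_single:
  assumes "distinct (map g xs)" "x \<in> set xs"
  shows "(\<Sum>y\<leftarrow>xs. if g y = g x then f y else 0) = (f x :: 'b :: comm_monoid_add)"
  using assms
proof (induction xs)
  case (Cons z xs)
  have zero: "(\<Sum>y\<leftarrow>xs. if g y = g z then f y else 0) = 0"
  proof -
    have "map (\<lambda>y. if g y = g z then f y else 0) xs = map (\<lambda>y. 0) xs"
      using Cons.prems by (auto simp: image_iff)
    then show ?thesis by (simp only: sum_list_0)
  qed
  show ?case
  proof (cases "x = z")
    case True
    then show ?thesis using zero by simp
  next
    case False
    then have "x \<in> set xs" using Cons.prems by simp
    then have "g z \<noteq> g x" using Cons.prems by auto
    then show ?thesis using Cons \<open>x \<in> set xs\<close> by simp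
  qed
qed simp

lemma arc_weight_altdef:
  "arc_weight a Unit = of_bool (arc_color a = Blue)"
  "arc_weight a (Ell i) = of_bool (fst a = i) - of_bool (snd (snd a) = i)"
  "arc_weight a (Rho i) =
     of_bool (arc_color a = Blue \<and> fst a = i) - of_bool (arc_color a = Red \<and> snd (snd a) = i)"
  by (cases a rule: arc_weight.cases; auto)+

lemma sum_list_zip_rotate1:
  fixes f g :: "'a \<Rightarrow> rat"
  shows "(\<Sum>(a, b)\<leftarrow>zip C (rotate1 C). f b - g a) = (\<Sum>a\<leftarrow>C. f a - g a)"
proof -
  have "(\<Sum>(a, b)\<leftarrow>zip C D. f b - g a) = (\<Sum>b\<leftarrow>D. f b) - (\<Sum>a\<leftarrow>C. g a)"
    if "length C = length D" for C D
    using that by (induction C D rule: list_induct2) auto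
  then show ?thesis by (simp add: sum_list_map_rotate1 sum_list_subtractf)
qed

theorem cycle_ineq_form:
  assumes "pre_digraph.cycle (key_graph n prec) C"
  shows "cycle_ineq C = (\<lambda>t. case t of
           Unit \<Rightarrow> of_nat (length (filter (\<lambda>a. arc_color a = Blue) C))
         | Ell i \<Rightarrow> 0
         | Rho i \<Rightarrow> of_bool (i \<in> mono_verts Blue C) - of_bool (i \<in> mono_verts Red C))"
proof
  note cyc = key_graph_cycle[OF assms]
  let ?hd = "\<lambda>a :: nat \<times> color \<times> nat. snd (snd a)"
  let ?Z = "zip C (rotate1 C)"
  have link: "fst b = ?hd a" if ab: "(a, b) \<in> set ?Z" for a b
  proof -
    obtain k where "k < length ?Z" "?Z ! k = (a, b)"
      using ab unfolding in_set_conv_nth by blast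
    then have k: "k < length C" "a = C ! k" "b = rotate1 C ! k" by auto
    then have "fst b = map fst (rotate1 C) ! k" by simp
    also have "\<dots> = ?hd a" unfolding cyc(3) using k by simp
    finally show ?thesis .
  qed
  have distZ: "distinct (map (\<lambda>p. ?hd (fst p)) ?Z)"
  proof -
    have "map (\<lambda>p. ?hd (fst p)) ?Z = map ?hd (map fst ?Z)"
      by (simp only: map_map comp_def)
    also have "map fst ?Z = C" by (rule map_fst_zip) simp
    finally show ?thesis using cyc(2) by simp
  qed
  fix t
  show "cycle_ineq C t = (case t of
           Unit \<Rightarrow> of_nat (length (filter (\<lambda>a. arc_color a = Blue) C))
         | Ell i \<Rightarrow> 0
         | Rho i \<Rightarrow> of_bool (i \<in> mono_verts Blue C) - of_bool (i \<in> mono_verts Red C))"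
  proof (cases t)
    case Unit
    have "(\<Sum>a\<leftarrow>C. of_bool (arc_color a = Blue) :: rat)
            = of_nat (length (filter (\<lambda>a. arc_color a = Blue) C))"
      by (induction C) auto
    then show ?thesis by (simp add: Unit cycle_ineq_def arc_weight_altdef)
  next
    case (Ell i)
    have "(\<Sum>a\<leftarrow>C. of_bool (fst a = i) :: rat) = (\<Sum>v\<leftarrow>map fst (rotate1 C). of_bool (v = i))"
      by (simp add: comp_def sum_list_map_rotate1)
    also have "\<dots> = (\<Sum>a\<leftarrow>C. of_bool (?hd a = i))" unfolding cyc(3) by (simp add: comp_def)
    finally show ?thesis
      by (simp add: Ell cycle_ineq_def arc_weight_altdef sum_list_subtractf)
  next
    case (Rho i)
    define F :: "(nat \<times> color \<times> nat) \<times> (nat \<times> color \<times> nat) \<Rightarrow> rat" where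
      "F = (\<lambda>(a, b). of_bool (arc_color b = Blue) - of_bool (arc_color a = Red))"
    have "cycle_ineq C t = (\<Sum>(a, b)\<leftarrow>?Z. of_bool (arc_color b = Blue \<and> fst b = i)
                               - of_bool (arc_color a = Red \<and> ?hd a = i))"
      by (simp add: Rho cycle_ineq_def arc_weight_altdef sum_list_zip_rotate1)
    also have "map (\<lambda>(a, b). of_bool (arc_color b = Blue \<and> fst b = i)
                               - of_bool (arc_color a = Red \<and> ?hd a = i)) ?Z
                 = map (\<lambda>p. if ?hd (fst p) = i then F p else 0) ?Z"
    proof (rule map_cong[OF refl])
      fix p assume p: "p \<in> set ?Z"
      obtain a b where ab: "p = (a, b)" by (rule prod.exhaust)
      have "fst b = ?hd a" using p unfolding ab by (rule link)
      then show "(case p of (a, b) \<Rightarrow> of_bool (arc_color b = Blue \<and> fst b = i)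
                    - of_bool (arc_color a = Red \<and> ?hd a = i))
                 = (if ?hd (fst p) = i then F p else 0)"
        by (simp add: ab F_def)
    qed
    finally have eq: "cycle_ineq C t = (\<Sum>p\<leftarrow>?Z. if ?hd (fst p) = i then F p else 0)" .
    show ?thesis
    proof (cases "\<exists>p\<in>set ?Z. ?hd (fst p) = i")
      case False
      then have "map (\<lambda>p. if ?hd (fst p) = i then F p else 0) ?Z = map (\<lambda>p. 0) ?Z"
        by (intro map_cong) auto
      then have "cycle_ineq C t = 0" unfolding eq by (simp only: sum_list_0)
      moreover have "i \<notin> mono_verts c C" for c
        using False unfolding mono_verts_def consecutive_def by force
      ultimately show ?thesis by (simp add: Rho)
    next
      case True
      then obtain p where p: "p \<in> set ?Z" "?hd (fst p) = i" by blast
      have val: "cycle_ineq C t = F p"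
        using sum_list_distinct_single[OF distZ p(1), of F] p(2) by (simp add: eq)
      have uniq: "q = p" if "q \<in> set ?Z" "?hd (fst q) = i" for q
        using distZ p that by (auto simp: distinct_map dest: inj_onD)
      have "i \<in> mono_verts c C \<longleftrightarrow> arc_color (fst p) = c \<and> arc_color (snd p) = c" for c
      proof
        assume "i \<in> mono_verts c C"
        then obtain a b where ab: "(a, b) \<in> set ?Z" "?hd a = i" "arc_color a = c" "arc_color b = c"
          unfolding mono_verts_def consecutive_def by blast
        then have "(a, b) = p" using uniq by simp
        then show "arc_color (fst p) = c \<and> arc_color (snd p) = c" using ab by auto
      next
        assume "arc_color (fst p) = c \<and> arc_color (snd p) = c"
        moreover have "(fst p, snd p) \<in> set ?Z" using p by simp
        ultimately show "i \<in> mono_verts c C"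
          using p(2) unfolding mono_verts_def consecutive_def by blast
      qed
      then show ?thesis
        unfolding val
        by (cases "arc_color (fst p)"; cases "arc_color (snd p)")
          (simp_all add: Rho F_def case_prod_beta)
    qed
  qed
qed

theorem cycle_ineq_data:
  assumes "pre_digraph.cycle (key_graph n prec) C"
  shows "ineq_gamma (cycle_ineq C) = of_nat (length (filter (\<lambda>a. arc_color a = Blue) C))"
    and "ineq_A (cycle_ineq C) = mono_verts Blue C"
    and "ineq_B (cycle_ineq C) = mono_verts Red C"
    and "mono_verts Blue C \<inter> mono_verts Red C = {}"
proof -
  have disj: "i \<notin> mono_verts Red C" if "i \<in> mono_verts Blue C" for i
  proof
    assume "i \<in> mono_verts Red C"
    then obtain a b where ab: "(a, b) \<in> consecutive C" "snd (snd a) = i" "arc_color a = Red"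
      unfolding mono_verts_def by blast
    from that obtain a' b' where ab': "(a', b') \<in> consecutive C" "snd (snd a') = i"
      "arc_color a' = Blue" unfolding mono_verts_def by blast
    have "a \<in> set C" "a' \<in> set C"
      using ab(1) ab'(1) unfolding consecutive_def by (auto dest: set_zip_leftD)
    then have "a = a'"
      using key_graph_cycle(2)[OF assms] ab(2) ab'(2) by (auto simp: distinct_map dest: inj_onD)
    then show False using ab(3) ab'(3) by simp
  qed
  then show "mono_verts Blue C \<inter> mono_verts Red C = {}" by blast
  show "ineq_gamma (cycle_ineq C) = of_nat (length (filter (\<lambda>a. arc_color a = Blue) C))"
    "ineq_A (cycle_ineq C) = mono_verts Blue C" "ineq_B (cycle_ineq C) = mono_verts Red C"
    using disj unfolding ineq_gamma_def ineq_A_def ineq_B_def cycle_ineq_form[OF assms]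
    by (auto simp: of_bool_def split: if_splits)
qed

end

theory Submission
  imports Defs
begin

text \<open>
  Whether \<open>\<rho>\<^sub>x \<rightarrow> \<rho>\<^sub>y\<close> is an arc of a given color depends only on a level (endpoint) attached to each
  of \<open>x\<close> and \<open>y\<close>, and the number of arcs of each color on each level of a cycle is a linear
  functional of its inequality. Let \<open>W\<close> be the inequality of a cycle \<open>C\<close> and suppose that \<open>W\<close> is a
  combination, with positive rational coefficients, of cycle inequalities \<open>V \<noteq> W\<close>. If \<open>C\<close> has two
  arcs of the same color on the same level, exchanging their heads cuts \<open>C\<close> into two closed walks.
  If some \<open>\<rho>\<^sub>x\<close> cancels in the combination, then \<open>C\<close> changes color on the levels of both endpoints
  of \<open>x\<close>, and both turns can be moved to \<open>x\<close>, so that the resulting closed walk is not a cycle.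
  Otherwise the number of arcs of \<open>V\<close> on the level and of the color of an arc of \<open>C\<close> is constant
  along \<open>C\<close>, so \<open>V\<close> is a multiple of \<open>W\<close>, hence \<open>W\<close>. In the first two cases \<open>W\<close> is a sum of at
  least two cycle inequalities, and these are then automatically smaller.
\<close>

abbreviation arc_head :: "nat \<times> color \<times> nat \<Rightarrow> nat" where
  "arc_head a \<equiv> snd (snd a)"

lemma cycle_ineq_append: "cycle_ineq (C @ D) = (\<lambda>t. cycle_ineq C t + cycle_ineq D t)"
  by (simp add: cycle_ineq_def)

lemma cycle_ineq_Cons: "cycle_ineq (a # C) = (\<lambda>t. arc_weight a t + cycle_ineq C t)"
  by (simp add: cycle_ineq_def)

lemma two_filtered_split:
  assumes "2 \<le> length (filter P xs)"
  obtains us a vs b ws where "xs = us @ a # vs @ b # ws" "P a" "P b"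
proof -
  obtain a b zs where ab: "filter P xs = a # b # zs"
    using assms by (metis Suc_le_length_iff numeral_2_eq_2)
  obtain us ys where "xs = us @ a # ys" "P a" "filter P ys = b # zs"
    using filter_eq_ConsD[OF ab] by metis
  moreover from this(3) obtain vs ws where "ys = vs @ b # ws" "P b"
    by (metis filter_eq_Cons_iff)
  ultimately show thesis by (intro that[of us a vs b ws]) auto
qed

subsection \<open>Closed walks\<close>

text \<open>A list is used so that repeated summands count: two copies of one cycle inequality are a
  splitting. This notion links redundancy to integral combinations of smaller inequalities.\<close>

definition splits :: "nat \<Rightarrow> (nat \<Rightarrow> nat \<Rightarrow> bool) \<Rightarrow> lin_ineq \<Rightarrow> bool" where
  "splits n prec W \<longleftrightarrow>
     (\<exists>Vs. set Vs \<subseteq> cycle_ineqs n prec \<and> 2 \<le> length Vs \<and> W = (\<lambda>t. \<Sum>V\<leftarrow>Vs. V t))"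

lemma wf_digraph_key_graph: "wf_digraph (key_graph n prec)"
  by unfold_locales (auto simp: key_graph_def slack_zero_def)

context
  fixes n :: nat and prec :: "nat \<Rightarrow> nat \<Rightarrow> bool"
begin

interpretation G: wf_digraph "key_graph n prec" by (rule wf_digraph_key_graph)

text \<open>A closed walk that repeats a vertex is cut there into two shorter closed walks, and
  \<open>cycle_ineq\<close> is additive. The disjunction records that a cut takes place unless
  \<open>C\<close> is already a cycle.\<close>

lemma closed_walk_decomposition:
  assumes "G.awalk u C u" "C \<noteq> []"
  shows "\<exists>Vs. set Vs \<subseteq> cycle_ineqs n prec \<and> Vs \<noteq> [] \<and> (G.cycle C \<or> 2 \<le> length Vs) \<and>
           cycle_ineq C = (\<lambda>t. \<Sum>V\<leftarrow>Vs. V t)"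
  using assms
proof (induction "length C" arbitrary: u C rule: less_induct)
  case less
  show ?case
  proof (cases "G.cycle C")
    case True
    then show ?thesis by (intro exI[of _ "[cycle_ineq C]"]) (auto simp: cycle_ineqs_def)
  next
    case False
    obtain e es where C: "C = e # es" using less.prems(2) by (cases C) auto
    have es: "e \<in> arcs (key_graph n prec)" "u = fst e" "G.awalk (arc_head e) es u"
      using less.prems(1) by (auto simp: C G.awalk_Cons_iff key_graph_simps)
    \<comment> \<open>The first vertex is left out because it recurs at the end of every closed
      walk. The cut then lies within \<open>es\<close>, so \<open>e\<close> stays outside the
      excised walk \<open>r\<close> and both pieces are nonempty.\<close>
    have "\<not> distinct (G.awalk_verts (arc_head e) es)"
      using False less.prems unfolding G.cycle_def C by (auto simp: key_graph_simps)
    from G.awalk_not_distinct_decomp[OF es(3) this] obtain q r s w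
      where d: "es = q @ r @ s" "r \<noteq> []" "G.awalk (arc_head e) q w" "G.awalk w r w"
        "G.awalk w s u" by auto
    have "G.awalk u (e # q @ s) u"
      using es d G.awends_of_awalk[OF d(3)] by (auto simp: G.awalk_Cons_iff key_graph_simps)
    from less.hyps[OF _ this] d(2) obtain Vs where
      Vs: "set Vs \<subseteq> cycle_ineqs n prec" "Vs \<noteq> []"
        "cycle_ineq (e # q @ s) = (\<lambda>t. \<Sum>V\<leftarrow>Vs. V t)"
      by (auto simp: C d(1))
    from less.hyps[OF _ d(4,2)] obtain Us where
      Us: "set Us \<subseteq> cycle_ineqs n prec" "Us \<noteq> []" "cycle_ineq r = (\<lambda>t. \<Sum>V\<leftarrow>Us. V t)"
      by (auto simp: C d(1))
    have "cycle_ineq C t = cycle_ineq (e # q @ s) t + cycle_ineq r t" for t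
      by (simp add: C d(1) cycle_ineq_def)
    then have "cycle_ineq C = (\<lambda>t. \<Sum>V\<leftarrow>Vs @ Us. V t)" unfolding Vs(3) Us(3) by auto
    moreover have "2 \<le> length (Vs @ Us)" using Vs(2) Us(2) by (cases Vs; cases Us) auto
    ultimately show ?thesis using Vs(1) Us(1) by (intro exI[of _ "Vs @ Us"]) auto
  qed
qed

lemma splits_non_cycle:
  assumes "G.awalk u C u" "C \<noteq> []" "\<not> G.cycle C"
  shows "splits n prec (cycle_ineq C)"
  using closed_walk_decomposition[OF assms(1,2)] assms(3) unfolding splits_def by blast

lemma splits_two_closed_walks:
  assumes "G.awalk u C u" "C \<noteq> []" "G.awalk v D v" "D \<noteq> []"
  shows "splits n prec (cycle_ineq (C @ D))"
proof -
  obtain Vs Us where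
    "set Vs \<subseteq> cycle_ineqs n prec" "Vs \<noteq> []" "cycle_ineq C = (\<lambda>t. \<Sum>V\<leftarrow>Vs. V t)"
    "set Us \<subseteq> cycle_ineqs n prec" "Us \<noteq> []" "cycle_ineq D = (\<lambda>t. \<Sum>V\<leftarrow>Us. V t)"
    using closed_walk_decomposition[OF assms(1,2)] closed_walk_decomposition[OF assms(3,4)]
    by metis
  then show ?thesis
    unfolding splits_def
    by (intro exI[of _ "Vs @ Us"]) (cases Vs; cases Us; auto simp: cycle_ineq_append)
qed

section \<open>Arcs and monochromatic vertices of a cycle\<close>

lemma cycle_arcs:
  assumes C: "G.cycle C"
  shows "set C \<subseteq> arcs (key_graph n prec)"
    and "\<exists>u. G.awalk u C u"
    and "inj_on arc_head (set C)" "inj_on fst (set C)"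
    and "a \<in> set C \<Longrightarrow> \<exists>b\<in>set C. fst b = arc_head a"
proof -
  show 1: "\<exists>u. G.awalk u C u" "set C \<subseteq> arcs (key_graph n prec)"
    using C by (auto simp: G.cycle_def)
  note cyc = key_graph_cycle[OF C]
  show "inj_on arc_head (set C)" using cyc(2) by (simp add: distinct_map)
  have "distinct (map fst (rotate1 C))" unfolding cyc(3) by (rule cyc(2))
  then show "inj_on fst (set C)" by (simp add: distinct_map)
  have "fst ` set C = arc_head ` set C"
    using arg_cong[OF cyc(3), of set] by simp
  then show "\<exists>b\<in>set C. fst b = arc_head a" if "a \<in> set C" using that by force
qed

lemma consecutive_link:
  assumes C: "G.cycle C" and ab: "(a, b) \<in> consecutive C"
  shows "a \<in> set C" "b \<in> set C" "fst b = arc_head a"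
proof -
  show "a \<in> set C" "b \<in> set C"
    using ab unfolding consecutive_def by (auto dest: set_zip_leftD set_zip_rightD)
  obtain k where k: "k < length C" "a = C ! k" "b = rotate1 C ! k"
    using ab unfolding consecutive_def by (auto simp: set_zip)
  then have "fst b = map fst (rotate1 C) ! k" by simp
  also have "\<dots> = arc_head a" unfolding key_graph_cycle(3)[OF C] using k by simp
  finally show "fst b = arc_head a" .
qed

lemma consecutive_exists:
  assumes C: "G.cycle C" and a: "a \<in> set C"
  shows "\<exists>b. (a, b) \<in> consecutive C"
  using a unfolding consecutive_def by (metis in_set_impl_in_set_zip1 length_rotate1)

text \<open>No two arcs of a cycle share a tail, so the arc following \<open>(p, c, y)\<close> is
  the only one leaving \<open>y\<close>; positions in the list can be replaced by
  membership.\<close>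

lemma mono_verts_iff:
  assumes C: "G.cycle C"
  shows "y \<in> mono_verts c C \<longleftrightarrow> (\<exists>p z. (p, c, y) \<in> set C \<and> (y, c, z) \<in> set C)"
proof
  assume "y \<in> mono_verts c C"
  then obtain a b where ab: "(a, b) \<in> consecutive C" "y = arc_head a" "arc_color a = c" "arc_color b = c"
    unfolding mono_verts_def by blast
  then show "\<exists>p z. (p, c, y) \<in> set C \<and> (y, c, z) \<in> set C"
    using consecutive_link[OF C ab(1)] by (cases a; cases b) auto
next
  assume "\<exists>p z. (p, c, y) \<in> set C \<and> (y, c, z) \<in> set C"
  then obtain p z where pz: "(p, c, y) \<in> set C" "(y, c, z) \<in> set C" by blast
  obtain b where b: "((p, c, y), b) \<in> consecutive C" using consecutive_exists[OF C pz(1)] by blast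
  have "b = (y, c, z)"
    using consecutive_link[OF C b] pz(2) inj_onD[OF cycle_arcs(4)[OF C], of b "(y, c, z)"] by auto
  then show "y \<in> mono_verts c C" using b unfolding mono_verts_def by force
qed

lemma cycle_constant:
  assumes C: "G.cycle C"
    and g: "\<And>a b. a \<in> set C \<Longrightarrow> b \<in> set C \<Longrightarrow> arc_head a = fst b \<Longrightarrow> g a = g b"
    and "a \<in> set C" "b \<in> set C"
  shows "g a = g b"
proof -
  have "\<forall>a\<in>set D. g a = g (hd D)"
    if "G.cas u D v" "\<And>a b. a \<in> set D \<Longrightarrow> b \<in> set D \<Longrightarrow> arc_head a = fst b \<Longrightarrow> g a = g b" for u v D
    using that
  proof (induction D arbitrary: u)
    case (Cons e D)
    show ?case
    proof (cases D)
      case (Cons f D')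
      have "\<forall>a\<in>set D. g a = g (hd D)"
        using Cons.IH Cons.prems by (auto simp: key_graph_simps)
      moreover have "g e = g f"
        using Cons.prems by (auto simp: Cons key_graph_simps)
      ultimately show ?thesis by (simp add: Cons)
    qed simp
  qed simp
  then show ?thesis
    using cycle_arcs(2)[OF C] g assms(3,4) unfolding G.awalk_def by metis
qed

text \<open>The tails and the heads of a closed walk form the same multiset.\<close>

lemma closed_walk_telescope:
  fixes \<phi> :: "nat \<Rightarrow> rat"
  assumes "G.awalk u C u"
  shows "(\<Sum>a\<leftarrow>C. \<phi> (fst a)) = (\<Sum>a\<leftarrow>C. \<phi> (arc_head a))"
proof -
  have "map fst C @ [u] = u # map arc_head C"
    using assms by (intro key_graph_cas[of n prec]) (simp add: G.awalk_def)
  from arg_cong[OF this, of "\<lambda>xs. \<Sum>x\<leftarrow>xs. \<phi> x"] show ?thesis by (simp add: comp_def)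
qed

end

section \<open>Signs of coefficients and the weak order\<close>

lemma cycle_ineq_values:
  assumes "V \<in> cycle_ineqs n prec"
  shows "V (Rho i) \<in> {-1, 0, 1}" "V (Ell i) = 0" "V Unit \<ge> 0"
    "V Unit = 0 \<Longrightarrow> V (Rho i) \<le> 0"
    "V Unit = 0 \<Longrightarrow> \<exists>i. V (Rho i) < 0"
    "V (Rho i) \<noteq> 0 \<Longrightarrow> i \<in> {1..n}"
proof -
  obtain C where C: "pre_digraph.cycle (key_graph n prec) C" and V: "V = cycle_ineq C"
    using assms unfolding cycle_ineqs_def by blast
  have form: "V (Rho i) = of_bool (i \<in> mono_verts Blue C) - of_bool (i \<in> mono_verts Red C)" for i
    by (simp add: V cycle_ineq_form[OF C])
  show "V (Rho i) \<in> {-1, 0, 1}" by (simp add: form)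
  show "V (Ell i) = 0" "V Unit \<ge> 0" by (simp_all add: V cycle_ineq_form[OF C])
  \<comment> \<open>With no blue arc, every vertex of the cycle lies between two red arcs and so
    belongs to \<open>B\<close>.\<close>
  have red: "arc_color a = Red" if "V Unit = 0" "a \<in> set C" for a
    using that by (cases "arc_color a") (auto simp: V cycle_ineq_form[OF C] filter_empty_conv)
  show "V (Rho i) \<le> 0" if "V Unit = 0"
    using red[OF that] by (force simp: form mono_verts_iff[OF C] of_bool_def)
  show "\<exists>i. V (Rho i) < 0" if z: "V Unit = 0"
  proof -
    obtain p c y where a: "(p, c, y) \<in> set C"
      using key_graph_cycle(1)[OF C] by (cases C) auto
    then obtain c' z where b: "(y, c', z) \<in> set C" using cycle_arcs(5)[OF C a] by auto
    have "c = Red" "c' = Red" using red[OF z a] red[OF z b] by auto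
    then have "y \<in> mono_verts Red C" using a b by (auto simp: mono_verts_iff[OF C])
    moreover have "y \<notin> mono_verts Blue C" using cycle_ineq_data(4)[OF C] calculation by blast
    ultimately show ?thesis by (intro exI[of _ y]) (simp add: form)
  qed
  show "i \<in> {1..n}" if "V (Rho i) \<noteq> 0"
  proof -
    have "i \<in> mono_verts Blue C \<or> i \<in> mono_verts Red C" using that by (auto simp: form)
    then obtain p c where "(p, c, i) \<in> set C" unfolding mono_verts_iff[OF C] by blast
    then have "(p, c, i) \<in> arcs (key_graph n prec)" using cycle_arcs(1)[OF C] by blast
    then show ?thesis by (auto simp: key_graph_def slack_zero_def)
  qed
qed

lemma finite_ineq_sets:
  assumes "V \<in> cycle_ineqs n prec"
  shows "finite (ineq_A V)" "finite (ineq_B V)"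
proof -
  have "ineq_A V \<subseteq> {1..n}" "ineq_B V \<subseteq> {1..n}"
    using cycle_ineq_values(6)[OF assms] unfolding ineq_A_def ineq_B_def by fastforce+
  then show "finite (ineq_A V)" "finite (ineq_B V)" by (auto intro: finite_subset)
qed

text \<open>Since no \<gamma> is negative, a vanishing total forces every summand to come from an
  all-red cycle. This controls what is left of a sum when one summand is taken out.\<close>

lemma sum_cycle_ineqs_nonneg:
  assumes "set Vs \<subseteq> cycle_ineqs n prec"
  shows "0 \<le> (\<Sum>V\<leftarrow>Vs. V Unit)"
    and "(\<Sum>V\<leftarrow>Vs. V Unit) = 0 \<Longrightarrow> (\<Sum>V\<leftarrow>Vs. V (Rho i)) \<le> 0"
    and "(\<Sum>V\<leftarrow>Vs. V Unit) = 0 \<Longrightarrow> Vs \<noteq> [] \<Longrightarrow> \<exists>i. (\<Sum>V\<leftarrow>Vs. V (Rho i)) < 0"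
proof -
  have *: "0 \<le> (\<Sum>V\<leftarrow>Vs. V Unit) \<and>
      ((\<Sum>V\<leftarrow>Vs. V Unit) = 0 \<longrightarrow> (\<forall>i. (\<Sum>V\<leftarrow>Vs. V (Rho i)) \<le> 0) \<and>
        (Vs \<noteq> [] \<longrightarrow> (\<exists>i. (\<Sum>V\<leftarrow>Vs. V (Rho i)) < 0)))"
    using assms
  proof (induction Vs)
    case (Cons V Vs)
    have V: "V \<in> cycle_ineqs n prec" using Cons.prems by simp
    have nn: "0 \<le> V Unit" "0 \<le> (\<Sum>V\<leftarrow>Vs. V Unit)"
      using cycle_ineq_values(3)[OF V] Cons by auto
    show ?case
    proof (intro conjI impI)
      show "0 \<le> (\<Sum>V\<leftarrow>V # Vs. V Unit)" using nn by simp
      assume "(\<Sum>V\<leftarrow>V # Vs. V Unit) = 0"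
      then have 0: "V Unit = 0" "(\<Sum>V\<leftarrow>Vs. V Unit) = 0" using nn by auto
      have le: "V (Rho i) \<le> 0" "(\<Sum>V\<leftarrow>Vs. V (Rho i)) \<le> 0" for i
        using cycle_ineq_values(4)[OF V 0(1)] Cons 0 by auto
      show "\<forall>i. (\<Sum>V\<leftarrow>V # Vs. V (Rho i)) \<le> 0" using le by (simp add: add_nonpos_nonpos)
      obtain i where "V (Rho i) < 0" using cycle_ineq_values(5)[OF V 0(1)] by blast
      then show "\<exists>i. (\<Sum>V\<leftarrow>V # Vs. V (Rho i)) < 0"
        using le(2) by (intro exI[of _ i]) (simp add: add_neg_nonpos)
    qed
  qed simp
  then show "0 \<le> (\<Sum>V\<leftarrow>Vs. V Unit)"
    "(\<Sum>V\<leftarrow>Vs. V Unit) = 0 \<Longrightarrow> (\<Sum>V\<leftarrow>Vs. V (Rho i)) \<le> 0"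
    "(\<Sum>V\<leftarrow>Vs. V Unit) = 0 \<Longrightarrow> Vs \<noteq> [] \<Longrightarrow> \<exists>i. (\<Sum>V\<leftarrow>Vs. V (Rho i)) < 0"
    by blast+
qed

text \<open>
  If \<open>V\<close> and \<open>V + R\<close> have the same \<open>\<gamma>\<close>, then the cycles in \<open>R\<close> are entirely red, so \<open>R\<close> has only
  nonpositive coefficients, and removing it enlarges \<open>A\<close> or shrinks \<open>B\<close>.
\<close>

lemma summand_smaller:
  assumes V: "V \<in> cycle_ineqs n prec" and W: "W \<in> cycle_ineqs n prec"
    and Rs: "set Rs \<subseteq> cycle_ineqs n prec" "Rs \<noteq> []"
    and sum: "\<And>t. W t = V t + (\<Sum>R\<leftarrow>Rs. R t)"
  shows "smaller V W"
proof (cases "(\<Sum>R\<leftarrow>Rs. R Unit) = 0")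
  case False
  then have "V Unit < W Unit" using sum_cycle_ineqs_nonneg(1)[OF Rs(1)] by (simp add: sum)
  then show ?thesis by (simp add: smaller_def ineq_gamma_def)
next
  case True
  have \<gamma>: "ineq_gamma V = ineq_gamma W" using True by (simp add: sum ineq_gamma_def)
  have le: "W (Rho i) \<le> V (Rho i)" for i
    using sum_cycle_ineqs_nonneg(2)[OF Rs(1) True] by (simp add: sum)
  obtain i where i: "W (Rho i) < V (Rho i)"
    using sum_cycle_ineqs_nonneg(3)[OF Rs(1) True Rs(2)] by (auto simp: sum)
  have A: "ineq_A W \<subseteq> ineq_A V" and B: "ineq_B V \<subseteq> ineq_B W"
    using le unfolding ineq_A_def ineq_B_def by (auto intro: less_le_trans le_less_trans)
  show ?thesis
  proof (cases "ineq_A W = ineq_A V")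
    case False
    then have "card (ineq_A W) < card (ineq_A V)"
      using A finite_ineq_sets(1)[OF V] by (intro psubset_card_mono) auto
    then show ?thesis using \<gamma> by (simp add: smaller_def)
  next
    case True
    \<comment> \<open>Coefficients lie in {-1, 0, 1}, and equality of the sets \<open>A\<close>
      rules out a drop from 1; so the coefficient at \<open>i\<close> falls from 0 to -1 and
      \<open>i\<close> is new in \<open>B\<close>.\<close>
    have "\<not> (V (Rho i) > 0 \<and> W (Rho i) \<le> 0)" using True unfolding ineq_A_def
      by (metis mem_Collect_eq not_less)
    then have "V (Rho i) = 0" "W (Rho i) < 0"
      using i cycle_ineq_values(1)[OF V, of i] cycle_ineq_values(1)[OF W, of i] by auto
    then have "i \<in> ineq_B W - ineq_B V" by (simp add: ineq_B_def)
    then have "ineq_B V \<noteq> ineq_B W" by blast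
    then have "card (ineq_B V) < card (ineq_B W)"
      using B finite_ineq_sets(2)[OF W] by (intro psubset_card_mono) auto
    then show ?thesis using \<gamma> True by (simp add: smaller_def)
  qed
qed

lemma splits_imp_smaller_combination:
  assumes W: "W \<in> cycle_ineqs n prec" and "splits n prec W"
  shows "\<exists>S (c :: lin_ineq \<Rightarrow> nat). finite S \<and> S \<subseteq> {V \<in> cycle_ineqs n prec. smaller V W} \<and>
    W = (\<lambda>t. \<Sum>V\<in>S. of_nat (c V) * V t)"
proof -
  obtain Vs where Vs: "set Vs \<subseteq> cycle_ineqs n prec" "2 \<le> length Vs" "W = (\<lambda>t. \<Sum>V\<leftarrow>Vs. V t)"
    using assms(2) unfolding splits_def by blast
  have "smaller V W" if V: "V \<in> set Vs" for V
  proof (rule summand_smaller[OF _ W])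
    show "V \<in> cycle_ineqs n prec" using V Vs(1) by blast
    \<comment> \<open>Only one copy of \<open>V\<close> is removed, so the rest is nonempty even if
      all summands equal \<open>V\<close>.\<close>
    show "set (remove1 V Vs) \<subseteq> cycle_ineqs n prec" using Vs(1) set_remove1_subset by fast
    have "length (remove1 V Vs) = length Vs - 1" using V by (simp add: length_remove1)
    then show "remove1 V Vs \<noteq> []" using Vs(2) by auto
    show "W t = V t + (\<Sum>R\<leftarrow>remove1 V Vs. R t)" for t
      unfolding Vs(3) by (rule sum_list_map_remove1[OF V])
  qed
  moreover have "(\<Sum>V\<leftarrow>Vs. V t) = (\<Sum>V\<in>set Vs. of_nat (count_list Vs V) * V t)" for t :: monom
  proof (induction Vs)
    case (Cons U Vs)
    have "(\<Sum>V\<in>set (U # Vs). of_nat (count_list (U # Vs) V) * V t) =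
        (\<Sum>V\<in>set (U # Vs). of_nat (count_list Vs V) * V t + (if U = V then V t else 0))"
      by (intro sum.cong) (auto simp: algebra_simps)
    also have "\<dots> = (\<Sum>V\<in>set (U # Vs). of_nat (count_list Vs V) * V t) + U t"
      by (simp add: sum.distrib del: set_simps) simp
    also have "(\<Sum>V\<in>set (U # Vs). of_nat (count_list Vs V) * V t) =
        (\<Sum>V\<in>set Vs. of_nat (count_list Vs V) * V t)"
      by (intro sum.mono_neutral_right) (auto simp: count_list_0_iff)
    finally show ?case using Cons by simp
  qed simp
  ultimately show ?thesis
    using Vs by (intro exI[of _ "set Vs"] exI[of _ "count_list Vs"]) auto
qed


subsection \<open>Levels\<close>

text \<open>
  With integral endpoints \<open>l\<close>, \<open>r\<close>, an arc of color \<open>c\<close> from \<open>x\<close> to \<open>y\<close> exists iff it leaves \<open>x\<close> on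
  the level on which it enters \<open>y\<close>. So two arcs of the same color on the same level may
  exchange their heads.
\<close>

definition color_sign :: "color \<Rightarrow> rat" where
  "color_sign c = (case c of Blue \<Rightarrow> 1 | Red \<Rightarrow> -1)"

text \<open>The coefficient is 1 at a vertex between two blue arcs, -1 between two red arcs and 0
  otherwise; the factor \<open>color_sign c\<close> lets both colors be treated at once.\<close>

lemma color_sign_mult_iff:
  assumes C: "pre_digraph.cycle (key_graph n prec) C"
  shows "color_sign c * cycle_ineq C (Rho y) > 0 \<longleftrightarrow>
    (\<exists>p z. (p, c, y) \<in> set C \<and> (y, c, z) \<in> set C)"
proof -
  have "y \<notin> mono_verts Blue C \<or> y \<notin> mono_verts Red C" using cycle_ineq_data(4)[OF C] by blast
  then show ?thesis
    unfolding mono_verts_iff[OF C, symmetric]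
    by (cases c) (auto simp: cycle_ineq_form[OF C] color_sign_def)
qed

lemma color_sign_mult_le_1: "V \<in> cycle_ineqs n prec \<Longrightarrow> color_sign c * V (Rho y) \<le> 1"
  using cycle_ineq_values(1)[of V n prec y] by (cases c) (auto simp: color_sign_def)

lemma color_sign_mult_cases:
  assumes "V \<in> cycle_ineqs n prec"
  obtains "V (Rho y) = 0" | c where "color_sign c * V (Rho y) = 1"
  using cycle_ineq_values(1)[OF assms, of y] that(1) that(2)[of Blue] that(2)[of Red]
  by (auto simp: color_sign_def)

text \<open>The canonical representation with integer endpoints. The red case includes the loops:
  for \<open>x = y\<close> it says that the interval is a point.\<close>

locale key_levels =
  fixes n :: nat and prec :: "nat \<Rightarrow> nat \<Rightarrow> bool" and l r :: "nat \<Rightarrow> int"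
  assumes l_le_r: "x \<in> {1..n} \<Longrightarrow> l x \<le> r x"
    and arcs_key_graph: "arcs (key_graph n prec) =
      {(x, c, y). x \<in> {1..n} \<and> y \<in> {1..n} \<and>
        (case c of Blue \<Rightarrow> r x + 1 = l y | Red \<Rightarrow> l x = r y)}"
begin

sublocale G: wf_digraph "key_graph n prec" by (rule wf_digraph_key_graph)

definition start_level :: "color \<Rightarrow> nat \<Rightarrow> int" where
  "start_level c x = (case c of Blue \<Rightarrow> r x + 1 | Red \<Rightarrow> l x)"

definition end_level :: "color \<Rightarrow> nat \<Rightarrow> int" where
  "end_level c y = (case c of Blue \<Rightarrow> l y | Red \<Rightarrow> r y)"

lemma arc_iff: "(x, c, y) \<in> arcs (key_graph n prec) \<longleftrightarrow>
    x \<in> {1..n} \<and> y \<in> {1..n} \<and> start_level c x = end_level c y"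
  unfolding arcs_key_graph start_level_def end_level_def by (cases c) auto

text \<open>
  The number of arcs of color \<open>c\<close> on level \<open>k\<close> of a cycle, as a linear functional of its
  inequality.
\<close>

definition crossing :: "color \<Rightarrow> int \<Rightarrow> lin_ineq \<Rightarrow> rat" where
  "crossing c k V =
     - (\<Sum>x\<in>{1..n}. of_bool ((case c of Blue \<Rightarrow> l x < k | Red \<Rightarrow> l x \<le> k) \<and> k \<le> r x) * V (Rho x))"

lemma crossing_sum:
  "crossing c k (\<lambda>t. \<Sum>V\<in>S. \<alpha> V * V t) = (\<Sum>V\<in>S. \<alpha> V * crossing c k V)"
  unfolding crossing_def sum_negf sum_distrib_left mult_minus_right
  by (subst sum.swap) (simp add: algebra_simps)

section \<open>Counting arcs by potentials\<close>

lemma weighted_Rho_sum: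
  fixes h :: "nat \<Rightarrow> rat"
  assumes "set C \<subseteq> arcs (key_graph n prec)"
  shows "(\<Sum>x\<in>{1..n}. h x * cycle_ineq C (Rho x)) =
    (\<Sum>a\<leftarrow>C. if arc_color a = Blue then h (fst a) else - h (arc_head a))"
  using assms
proof (induction C)
  case Nil
  then show ?case by (simp add: cycle_ineq_def)
next
  case (Cons a C)
  obtain p c q where a: "a = (p, c, q)" by (rule prod_cases3)
  have pq: "p \<in> {1..n}" "q \<in> {1..n}" using Cons.prems by (auto simp: a arc_iff)
  have "(\<Sum>x\<in>{1..n}. h x * arc_weight a (Rho x)) =
      (\<Sum>x\<in>{1..n}. if c = Blue then (if p = x then h x else 0) else - (if q = x then h x else 0))"
    by (intro sum.cong) (cases c; auto simp: a arc_weight_altdef)+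
  also have "\<dots> = (if c = Blue then h p else - h q)"
    using pq by (cases c) (simp_all add: sum_negf)
  finally have "(\<Sum>x\<in>{1..n}. h x * arc_weight a (Rho x)) = (if c = Blue then h p else - h q)" .
  then show ?case
    using Cons by (simp add: a cycle_ineq_Cons distrib_left sum.distrib)
qed

text \<open>If each arc contributes a potential difference minus the indicator of \<open>P\<close>,
  the differences cancel around the closed walk and only the count of \<open>P\<close>
  remains.\<close>

lemma potential_Rho_sum:
  fixes h \<phi> :: "nat \<Rightarrow> rat"
  assumes C: "G.awalk u C u"
    and h: "\<And>a. a \<in> set C \<Longrightarrow> (if arc_color a = Blue then h (fst a) else - h (arc_head a)) =
      \<phi> (fst a) - \<phi> (arc_head a) - of_bool (P a)"
  shows "(\<Sum>x\<in>{1..n}. h x * cycle_ineq C (Rho x)) = - of_nat (length (filter P C))"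
proof -
  have "(\<Sum>a\<leftarrow>C. of_bool (P a)) = (of_nat (length (filter P C)) :: rat)"
    by (induction C) auto
  moreover have "(\<Sum>x\<in>{1..n}. h x * cycle_ineq C (Rho x)) =
      (\<Sum>a\<leftarrow>C. \<phi> (fst a) - \<phi> (arc_head a) - of_bool (P a))"
    using C h by (subst weighted_Rho_sum) (auto simp: G.awalk_def cong: map_cong)
  ultimately show ?thesis
    using closed_walk_telescope[OF C, of \<phi>] by (simp add: sum_list_subtractf)
qed

text \<open>Follow the left endpoint of the current vertex: a blue arc raises it from
  \<open>l x\<close> to \<open>r x + 1\<close>, a red arc lowers it from \<open>r y\<close> to
  \<open>l y\<close>. The potential marks left endpoints below \<open>k\<close> (for red, at most
  \<open>k\<close>). Its change along an arc is the coverage of \<open>k\<close> by the interval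
  passed, corrected by 1 exactly at the arcs counted.\<close>

lemma crossing_cycle:
  assumes "G.awalk u C u"
  shows "crossing c k (cycle_ineq C) =
    of_nat (length (filter (\<lambda>a. arc_color a = c \<and> end_level c (arc_head a) = k) C))"
proof -
  define h :: "nat \<Rightarrow> rat" where
    "h = (\<lambda>x. of_bool ((case c of Blue \<Rightarrow> l x < k | Red \<Rightarrow> l x \<le> k) \<and> k \<le> r x))"
  define \<phi> :: "nat \<Rightarrow> rat" where "\<phi> = (\<lambda>x. of_bool (case c of Blue \<Rightarrow> l x < k | Red \<Rightarrow> l x \<le> k))"
  have "(\<Sum>x\<in>{1..n}. h x * cycle_ineq C (Rho x)) =
      - of_nat (length (filter (\<lambda>a. arc_color a = c \<and> end_level c (arc_head a) = k) C))"
  proof (rule potential_Rho_sum[OF assms, where \<phi> = \<phi>])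
    fix a assume "a \<in> set C"
    obtain x d y where a: "a = (x, d, y)" by (rule prod_cases3)
    have xy: "(x, d, y) \<in> arcs (key_graph n prec)"
      using assms \<open>a \<in> set C\<close> by (auto simp: G.awalk_def a)
    then have "l x \<le> r x" "l y \<le> r y" "start_level d x = end_level d y"
      using l_le_r by (auto simp: arc_iff)
    then show "(if arc_color a = Blue then h (fst a) else - h (arc_head a)) =
      \<phi> (fst a) - \<phi> (arc_head a) - of_bool (arc_color a = c \<and> end_level c (arc_head a) = k)"
      by (cases c; cases d) (auto simp: a h_def \<phi>_def start_level_def end_level_def)
  qed
  then show ?thesis unfolding crossing_def h_def by simp
qed

text \<open>The left endpoint rises by \<open>r x - l x + 1\<close> along a blue arc and falls by
  \<open>r y - l y\<close> along a red one. Hence the coefficients of the \<rho> variables determine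
  the whole cycle inequality.\<close>

lemma cycle_ineq_Unit:
  assumes "V \<in> cycle_ineqs n prec"
  shows "V Unit = - (\<Sum>x\<in>{1..n}. of_int (r x - l x) * V (Rho x))"
proof -
  obtain C where C: "G.cycle C" "V = cycle_ineq C"
    using assms unfolding cycle_ineqs_def by blast
  then obtain u where u: "G.awalk u C u" using cycle_arcs(2) by blast
  have "(\<Sum>x\<in>{1..n}. of_int (r x - l x) * cycle_ineq C (Rho x)) =
      - of_nat (length (filter (\<lambda>a. arc_color a = Blue) C))"
  proof (rule potential_Rho_sum[OF u, where \<phi> = "\<lambda>x. - of_int (l x)"])
    fix a assume "a \<in> set C"
    obtain x d y where a: "a = (x, d, y)" by (rule prod_cases3)
    have "start_level d x = end_level d y"
      using u \<open>a \<in> set C\<close> by (auto simp: G.awalk_def a arc_iff)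
    then show "(if arc_color a = Blue then of_int (r (fst a) - l (fst a))
        else - of_int (r (arc_head a) - l (arc_head a))) =
      - of_int (l (fst a)) - - of_int (l (arc_head a)) - (of_bool (arc_color a = Blue) :: rat)"
      by (cases d) (auto simp: a start_level_def end_level_def algebra_simps simp flip: of_int_add)
  qed
  then show ?thesis unfolding C(2) by (simp add: cycle_ineq_form[OF C(1)])
qed

lemma cycle_ineq_eqI:
  assumes "V \<in> cycle_ineqs n prec" "W \<in> cycle_ineqs n prec" "\<And>x. V (Rho x) = W (Rho x)"
  shows "V = W"
proof
  show "V t = W t" for t
    using assms cycle_ineq_values(2)[OF assms(1)] cycle_ineq_values(2)[OF assms(2)]
      cycle_ineq_Unit[OF assms(1)] cycle_ineq_Unit[OF assms(2)] by (cases t) auto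
qed

lemma cycle_ineq_nonzero:
  assumes "V \<in> cycle_ineqs n prec"
  shows "\<exists>x. V (Rho x) \<noteq> 0"
proof (rule ccontr)
  assume zero: "\<not> ?thesis"
  then have "V Unit = 0" by (simp add: cycle_ineq_Unit[OF assms])
  from cycle_ineq_values(5)[OF assms this] zero show False by auto
qed

lemma crossing_ge_card:
  assumes C: "G.cycle C" and X: "finite X"
    and "\<And>a. a \<in> X \<Longrightarrow> a \<in> set C \<and> arc_color a = c \<and> end_level c (arc_head a) = k"
  shows "of_nat (card X) \<le> crossing c k (cycle_ineq C)"
proof -
  let ?F = "filter (\<lambda>a. arc_color a = c \<and> end_level c (arc_head a) = k) C"
  have "card X \<le> card (set ?F)" using assms(3) by (intro card_mono) auto
  also have "\<dots> \<le> length ?F" by (rule card_length)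
  finally have "card X \<le> length ?F" .
  then show ?thesis using cycle_arcs(2)[OF C] by (auto simp: crossing_cycle)
qed

lemma crossing_nonneg: "V \<in> cycle_ineqs n prec \<Longrightarrow> 0 \<le> crossing c k V"
  using crossing_ge_card[of _ "{}"] unfolding cycle_ineqs_def by fastforce

text \<open>A positive left side means that the cycle enters and leaves \<open>y\<close> by arcs of
  color \<open>c\<close>, which lie on these two levels. Tightness of these bounds drives the main
  argument.\<close>

lemma crossing_ge_end:
  assumes V: "V \<in> cycle_ineqs n prec"
  shows "color_sign c * V (Rho y) \<le> crossing c (end_level c y) V"
    and "color_sign c * V (Rho y) \<le> crossing c (start_level c y) V"
proof -
  obtain C where C: "G.cycle C" "V = cycle_ineq C" using V unfolding cycle_ineqs_def by blast
  have "color_sign c * V (Rho y) \<le> crossing c (end_level c y) V \<and>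
      color_sign c * V (Rho y) \<le> crossing c (start_level c y) V"
  proof (cases "color_sign c * V (Rho y) > 0")
    case True
    then obtain p z where pz: "(p, c, y) \<in> set C" "(y, c, z) \<in> set C"
      unfolding C(2) color_sign_mult_iff[OF C(1)] by blast
    moreover have "start_level c y = end_level c z"
      using pz cycle_arcs(1)[OF C(1)] arc_iff by blast
    ultimately show ?thesis
      using crossing_ge_card[OF C(1), of "{(p, c, y)}" c] crossing_ge_card[OF C(1), of "{(y, c, z)}" c]
        color_sign_mult_le_1[OF V, of c y] by (fastforce simp: C(2))
  next
    case False
    then show ?thesis
      using crossing_nonneg[OF V, of c "end_level c y"] crossing_nonneg[OF V, of c "start_level c y"]
      by auto
  qed
  then show "color_sign c * V (Rho y) \<le> crossing c (end_level c y) V"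
    "color_sign c * V (Rho y) \<le> crossing c (start_level c y) V" by blast+
qed

text \<open>The arc entering \<open>x\<close> is a further arc on the level of \<open>y\<close>, so
  the bound at \<open>y\<close> is not attained.\<close>

lemma crossing_gt_end:
  assumes V: "V \<in> cycle_ineqs n prec"
    and xy: "x \<noteq> y" "end_level c x = end_level c y" "color_sign c * V (Rho x) > 0"
  shows "color_sign c * V (Rho y) < crossing c (end_level c y) V"
proof -
  obtain C where C: "G.cycle C" "V = cycle_ineq C" using V unfolding cycle_ineqs_def by blast
  obtain p where p: "(p, c, x) \<in> set C"
    using xy(3) unfolding C(2) color_sign_mult_iff[OF C(1)] by blast
  have p1: "1 \<le> crossing c (end_level c y) V"
    using crossing_ge_card[OF C(1), of "{(p, c, x)}" c] p xy(2) by (auto simp: C(2))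
  show ?thesis
  proof (cases "color_sign c * V (Rho y) > 0")
    case True
    then obtain q where q: "(q, c, y) \<in> set C"
      unfolding C(2) color_sign_mult_iff[OF C(1)] by blast
    have "of_nat (card {(p, c, x), (q, c, y)}) \<le> crossing c (end_level c y) V"
      unfolding C(2) using p q xy(2) by (intro crossing_ge_card[OF C(1)]) auto
    then show ?thesis using xy(1) color_sign_mult_le_1[OF V, of c y] by simp
  qed (use p1 in auto)
qed

section \<open>Splitting by exchanged heads and by moved turns\<close>

lemma splits_crossing:
  assumes C: "G.cycle C" and "crossing c k (cycle_ineq C) > 1"
  shows "splits n prec (cycle_ineq C)"
proof -
  obtain u where u: "G.awalk u C u" using cycle_arcs(2)[OF C] by blast
  have "2 \<le> length (filter (\<lambda>a. arc_color a = c \<and> end_level c (arc_head a) = k) C)"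
    using assms(2) by (simp add: crossing_cycle[OF u])
  then obtain us a vs b ws where C_eq: "C = us @ a # vs @ b # ws"
    and "arc_color a = c \<and> end_level c (arc_head a) = k" "arc_color b = c \<and> end_level c (arc_head b) = k"
    by (rule two_filtered_split)
  then obtain p q p' q' where a: "a = (p, c, q)" "b = (p', c, q')"
    and k: "end_level c q = k" "end_level c q' = k" by (cases a; cases b) auto
  have w: "G.awalk u us p" "(p, c, q) \<in> arcs (key_graph n prec)" "G.awalk q vs p'"
    "(p', c, q') \<in> arcs (key_graph n prec)" "G.awalk q' ws u"
    using u by (auto simp: C_eq a G.awalk_Cons_iff key_graph_simps)
  \<comment> \<open>The heads \<open>q\<close> and \<open>q'\<close> change places, which is
    possible as they have the same end level.\<close>
  have "G.awalk u (us @ (p, c, q') # ws) u"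
    using w k by (auto simp: G.awalk_Cons_iff key_graph_simps arc_iff)
  moreover have "G.awalk p' ((p', c, q) # vs) p'"
    using w k by (auto simp: G.awalk_Cons_iff key_graph_simps arc_iff)
  ultimately have "splits n prec (cycle_ineq ((us @ (p, c, q') # ws) @ ((p', c, q) # vs)))"
    by (intro splits_two_closed_walks) auto
  \<comment> \<open>An arc weight is a term in color and tail plus a term in color and head, so the
    exchange preserves the sum.\<close>
  also have "cycle_ineq ((us @ (p, c, q') # ws) @ ((p', c, q) # vs)) = cycle_ineq C"
    unfolding C_eq a by (cases c) (auto simp: cycle_ineq_def)
  finally show ?thesis .
qed


text \<open>Both sides sum over intervals containing the endpoint of \<open>y\<close> at which the
  color changes: \<open>r y\<close> from red to blue, \<open>l y\<close> from blue to red. The two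
  ranges differ exactly in the intervals sharing that endpoint, where \<open>V\<close>
  vanishes.\<close>

lemma crossing_turn:
  assumes "c \<noteq> d" and zero: "\<And>x. x \<in> {1..n} \<Longrightarrow> end_level c x = end_level c y \<Longrightarrow> V (Rho x) = 0"
  shows "crossing c (end_level c y) V = crossing d (start_level d y) V"
  unfolding crossing_def neg_equal_iff_equal
proof (intro sum.cong refl)
  fix x assume x: "x \<in> {1..n}"
  show "of_bool ((case c of Blue \<Rightarrow> l x < end_level c y | Red \<Rightarrow> l x \<le> end_level c y) \<and>
      end_level c y \<le> r x) * V (Rho x) =
    of_bool ((case d of Blue \<Rightarrow> l x < start_level d y | Red \<Rightarrow> l x \<le> start_level d y) \<and>
      start_level d y \<le> r x) * V (Rho x)"
    using assms(1) zero[OF x] l_le_r[OF x]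
    by (cases c; cases d) (auto simp: start_level_def end_level_def of_bool_def)
qed

text \<open>The turn from red to blue at \<open>y\<close> involves only \<open>r y\<close>, the turn
  from blue to red at \<open>y'\<close> only \<open>l y'\<close>. Both can therefore be moved to
  \<open>x\<close>, which is then visited more than once.\<close>

lemma splits_reroute:
  assumes C: "G.cycle C"
    and a: "(p, Red, y) \<in> set C" "(y, Blue, z) \<in> set C"
    and b: "(p', Blue, y') \<in> set C" "(y', Red, z') \<in> set C"
    and x: "x \<in> {1..n}" "r y = r x" "l y' = l x" "cycle_ineq C (Rho x) = 0"
  shows "splits n prec (cycle_ineq C)"
proof -
  obtain u where u: "G.awalk u C u" using cycle_arcs(2)[OF C] by blast
  note arcs = cycle_arcs(1)[OF C]
  have heads: "a = a'" if "a \<in> set C" "a' \<in> set C" "arc_head a = arc_head a'" for a a'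
    using inj_onD[OF cycle_arcs(3)[OF C]] that by blast
  have tails: "a = a'" if "a \<in> set C" "a' \<in> set C" "fst a = fst a'" for a a'
    using inj_onD[OF cycle_arcs(4)[OF C]] that by blast
  have yy': "y \<noteq> y'" using heads[OF a(1) b(1)] by auto
  \<comment> \<open>The color changes at \<open>y\<close> and at \<open>y'\<close>, so their
    coefficients are 0, like that of \<open>x\<close>; identifying the three vertices will not alter
    the inequality.\<close>
  have turn: "cycle_ineq C (Rho v) = 0" if v: "v \<in> {x, y, y'}" for v
  proof -
    have "cycle_ineq C \<in> cycle_ineqs n prec" using C by (auto simp: cycle_ineqs_def)
    then show ?thesis
    proof (cases rule: color_sign_mult_cases[where y = v])
      case (2 c)
      then obtain s t where "(s, c, v) \<in> set C" "(v, c, t) \<in> set C"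
        using color_sign_mult_iff[OF C, of c v] by auto
      moreover have False if "v = y"
        using heads[OF a(1) calculation(1)] tails[OF a(2) calculation(2)] that by simp
      moreover have False if "v = y'"
        using heads[OF b(1) calculation(1)] tails[OF b(2) calculation(2)] that by simp
      ultimately show ?thesis using v x(4) by blast
    qed
  qed
  define \<phi> where "\<phi> = (\<lambda>v. if v = y \<or> v = y' then x else v)"
  define D where "D = map (\<lambda>(s, c, t). (\<phi> s, c, \<phi> t)) C"
  have D_arcs: "(\<phi> s, c, \<phi> t) \<in> arcs (key_graph n prec)" if e: "(s, c, t) \<in> set C" for s c t
  proof -
    have st: "s \<in> {1..n}" "t \<in> {1..n}" "start_level c s = end_level c t"
      using arcs e arc_iff by blast+
    have "start_level c (\<phi> s) = start_level c s"
      using tails[OF a(2) e] tails[OF b(2) e] x(2,3) by (auto simp: \<phi>_def start_level_def)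
    moreover have "end_level c (\<phi> t) = end_level c t"
      using heads[OF a(1) e] heads[OF b(1) e] x(2,3) by (auto simp: \<phi>_def end_level_def)
    moreover have "\<phi> s \<in> {1..n}" "\<phi> t \<in> {1..n}" using st x(1) by (auto simp: \<phi>_def)
    ultimately show ?thesis using st by (simp add: arc_iff)
  qed
  have cas: "G.cas (\<phi> v) (map (\<lambda>(s, c, t). (\<phi> s, c, \<phi> t)) E) (\<phi> w)" if "G.cas v E w" for v E w
    using that by (induction E arbitrary: v) (auto simp: key_graph_simps)
  have walk: "G.awalk (\<phi> u) D (\<phi> u)"
    using u D_arcs x(1) cas[of u C u] unfolding G.awalk_def D_def
    by (auto simp: key_graph_simps \<phi>_def)
  have "\<not> G.cycle D"
  proof
    assume "G.cycle D"
    then have "distinct (map arc_head D)" by (rule key_graph_cycle(2))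
    then have "inj_on (\<lambda>a. \<phi> (arc_head a)) (set C)"
      unfolding D_def by (simp add: distinct_map comp_def case_prod_beta)
    from inj_onD[OF this _ a(1) b(1)] show False by (simp add: \<phi>_def)
  qed
  then have split: "splits n prec (cycle_ineq D)"
    using walk key_graph_cycle(1)[OF C] by (intro splits_non_cycle[of n prec "\<phi> u"]) (auto simp: D_def)
  have "cycle_ineq D t = cycle_ineq C t" for t
  proof (cases t)
    case Unit
    then show ?thesis by (simp add: D_def cycle_ineq_def arc_weight_altdef comp_def case_prod_beta)
  next
    case (Ell i)
    have "cycle_ineq E (Ell i) = 0" if "G.awalk v E v" for v E
      using closed_walk_telescope[OF that, of "\<lambda>v. of_bool (v = i)"]
      by (simp add: cycle_ineq_def arc_weight_altdef sum_list_subtractf)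
    then show ?thesis using u walk Ell by simp
  next
    case (Rho i)
    have "cycle_ineq D (Rho i) =
        (\<Sum>a\<leftarrow>C. if arc_color a = Blue then of_bool (\<phi> (fst a) = i) else - of_bool (\<phi> (arc_head a) = i))"
      unfolding cycle_ineq_def D_def map_map comp_def
    proof (intro arg_cong[of _ _ sum_list] map_cong refl)
      fix a :: "nat \<times> color \<times> nat"
      obtain s c t where "a = (s, c, t)" by (rule prod_cases3)
      then show "arc_weight (case a of (s, c, t) \<Rightarrow> (\<phi> s, c, \<phi> t)) (Rho i) =
          (if arc_color a = Blue then of_bool (\<phi> (fst a) = i) else - of_bool (\<phi> (arc_head a) = i))"
        by (cases c) (simp_all add: arc_weight_altdef)
    qed
    \<comment> \<open>The inequality of \<open>D\<close> is read off from \<open>C\<close>, with the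
      indicator of \<open>\<phi> v = i\<close> as vertex weight.\<close>
    also have "\<dots> = (\<Sum>v\<in>{1..n}. of_bool (\<phi> v = i) * cycle_ineq C (Rho v))"
      by (rule weighted_Rho_sum[OF arcs, symmetric])
    also have "\<dots> = (\<Sum>v\<in>{1..n}. if v = i then cycle_ineq C (Rho v) else 0)"
      using turn by (intro sum.cong) (auto simp: \<phi>_def)
    also have "\<dots> = cycle_ineq C (Rho i)"
      using cycle_ineq_values(6)[of "cycle_ineq C" n prec i] C by (auto simp: cycle_ineqs_def)
    finally show ?thesis using Rho by simp
  qed
  then have "cycle_ineq D = cycle_ineq C" by blast
  then show ?thesis using split by simp
qed

section \<open>Rigidity of combinations giving an inequality that does not split\<close>

lemma redundant_imp_splits:
  assumes W: "W \<in> cycle_ineqs n prec" and "redundant n prec W"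
  shows "splits n prec W"
proof (rule ccontr)
  assume ns: "\<not> splits n prec W"
  obtain C where C: "G.cycle C" "W = cycle_ineq C" using W unfolding cycle_ineqs_def by blast
  obtain S\<^sub>0 \<alpha> where S\<^sub>0: "finite S\<^sub>0" "S\<^sub>0 \<subseteq> {V \<in> cycle_ineqs n prec. V \<noteq> W}"
    "\<forall>V\<in>S\<^sub>0. \<alpha> V \<ge> 0" "W = (\<lambda>t. \<Sum>V\<in>S\<^sub>0. \<alpha> V * V t)"
    using assms(2) unfolding redundant_def by blast
  define S where "S = {V \<in> S\<^sub>0. \<alpha> V > 0}"
  have S: "finite S" "\<And>V. V \<in> S \<Longrightarrow> V \<in> cycle_ineqs n prec" "W \<notin> S" "\<And>V. V \<in> S \<Longrightarrow> \<alpha> V > 0"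
    using S\<^sub>0 by (auto simp: S_def)
  have "(\<Sum>V\<in>S\<^sub>0. \<alpha> V * V t) = (\<Sum>V\<in>S. \<alpha> V * V t)" for t
    using S\<^sub>0(1,3) by (intro sum.mono_neutral_right) (auto simp: S_def less_le)
  then have W_sum: "W = (\<lambda>t. \<Sum>V\<in>S. \<alpha> V * V t)" using S\<^sub>0(4) by simp
  have W_crossing: "crossing c k W = (\<Sum>V\<in>S. \<alpha> V * crossing c k V)" for c k
    unfolding W_sum by (rule crossing_sum)
  have le1: "crossing c k W \<le> 1" for c k
    using splits_crossing[OF C(1), of c k] ns C(2) by fastforce
  \<comment> \<open>For \<open>W\<close> the count is at most 1, which is the value of the signed
    coefficient at \<open>y\<close>. As all weights are positive, the bound of
    \<open>crossing_ge_end\<close> is an equality for every summand.\<close>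
  have tight: "crossing c k V = color_sign c * V (Rho y)"
    if y: "color_sign c * W (Rho y) = 1" "k = end_level c y \<or> k = start_level c y" and V: "V \<in> S" for c k y V
  proof -
    have ge: "0 \<le> \<alpha> U * (crossing c k U - color_sign c * U (Rho y))" if "U \<in> S" for U
      using crossing_ge_end[OF S(2)[OF that], of c y] S(4)[OF that] y(2) by auto
    have "color_sign c * W (Rho y) = (\<Sum>U\<in>S. \<alpha> U * (color_sign c * U (Rho y)))"
      unfolding W_sum sum_distrib_left by (simp add: algebra_simps)
    then have "(\<Sum>U\<in>S. \<alpha> U * (crossing c k U - color_sign c * U (Rho y))) = crossing c k W - 1"
      using y(1) by (simp add: W_crossing right_diff_distrib sum_subtractf)
    then have "(\<Sum>U\<in>S. \<alpha> U * (crossing c k U - color_sign c * U (Rho y))) = 0"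
      using le1[of c k] sum_nonneg[of S "\<lambda>U. \<alpha> U * (crossing c k U - color_sign c * U (Rho y))"] ge
      by simp
    then have "\<alpha> V * (crossing c k V - color_sign c * V (Rho y)) = 0"
      by (intro sum_nonneg_0[OF S(1), where f = "\<lambda>U. \<alpha> U * (crossing c k U - color_sign c * U (Rho y))"]
          ge V)
    then show ?thesis using S(4)[OF V] by simp
  qed
  have used: "\<exists>p y. (p, c, y) \<in> set C \<and> end_level c y = k"
    if V: "V \<in> S" "crossing c k V > 0" for c k V
  proof -
    have "0 < (\<Sum>V\<in>S. \<alpha> V * crossing c k V)"
      using V S crossing_nonneg by (intro sum_pos2[OF S(1) V(1)]) (auto simp: less_imp_le)
    then have "crossing c k (cycle_ineq C) > 0" using W_crossing C(2) by simp
    then have "filter (\<lambda>a. arc_color a = c \<and> end_level c (arc_head a) = k) C \<noteq> []"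
      using cycle_arcs(2)[OF C(1)] by (auto simp: crossing_cycle)
    then obtain a where "a \<in> set C" "arc_color a = c" "end_level c (arc_head a) = k"
      by (auto simp: filter_empty_conv)
    then show ?thesis by (intro exI[of _ "fst a"] exI[of _ "arc_head a"]) auto
  qed
  have same_level: "(p, c, y) = (p', c, y')"
    if a: "(p, c, y) \<in> set C" "(p', c, y') \<in> set C" "end_level c y = end_level c y'" for p p' c y y'
  proof (rule ccontr)
    assume "\<not> ?thesis"
    then have card: "card {(p, c, y), (p', c, y')} = 2" by simp
    have "of_nat (card {(p, c, y), (p', c, y')}) \<le> crossing c (end_level c y) W"
      unfolding C(2) using a by (intro crossing_ge_card[OF C(1)]) auto
    then show False using le1[of c "end_level c y"] unfolding card by simp
  qed
  \<comment> \<open>\<open>C\<close> has an arc of color \<open>c\<close> on the level at which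
    \<open>V\<close> enters \<open>x\<close>; let \<open>y\<close> be its head. If \<open>C\<close>
    kept its color at \<open>y\<close>, the bound at \<open>y\<close> would be tight for
    \<open>V\<close>, whereas the arc of \<open>V\<close> into \<open>x\<close> makes it
    strict.\<close>
  have turn: "\<exists>p y z d. (p, c, y) \<in> set C \<and> (y, d, z) \<in> set C \<and> d \<noteq> c \<and> end_level c y = end_level c x"
    if V: "V \<in> S" "color_sign c * V (Rho x) > 0" and x: "W (Rho x) = 0" for c x V
  proof -
    have "crossing c (end_level c x) V > 0"
      using crossing_ge_end(1)[OF S(2)[OF V(1)], of c x] V(2) by simp
    then obtain p y where py: "(p, c, y) \<in> set C" "end_level c y = end_level c x"
      using used V(1) by blast
    obtain d z where yz: "(y, d, z) \<in> set C" using cycle_arcs(5)[OF C(1) py(1)] by auto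
    have "d \<noteq> c"
    proof
      assume "d = c"
      then have "color_sign c * W (Rho y) > 0"
        using py(1) yz unfolding C(2) color_sign_mult_iff[OF C(1)] by blast
      then have 1: "color_sign c * W (Rho y) = 1"
        using cycle_ineq_values(1)[OF W, of y] by (cases c) (auto simp: color_sign_def)
      then have "x \<noteq> y" using x by auto
      from crossing_gt_end[OF S(2)[OF V(1)] this _ V(2)] tight[OF 1 _ V(1)] py(2)
      show False by auto
    qed
    then show ?thesis using py yz by blast
  qed
  have zero: "V (Rho x) = 0" if V: "V \<in> S" and x: "W (Rho x) = 0" for V x
  proof (rule ccontr)
    assume nz: "V (Rho x) \<noteq> 0"
    have sum0: "(\<Sum>U\<in>S. \<alpha> U * U (Rho x)) = 0" using x W_sum by metis
    \<comment> \<open>Cancellation at \<open>x\<close> needs summands of both signs. They provide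
      turns of \<open>C\<close> at both endpoints of \<open>x\<close>, which can be
      rerouted.\<close>
    have pos: "\<exists>U\<in>S. s * U (Rho x) > 0" if s: "s = 1 \<or> s = -1" for s
    proof (rule ccontr)
      assume "\<not> ?thesis"
      then have le: "0 \<le> - s * (\<alpha> U * U (Rho x))" if "U \<in> S" for U
        using that S(4)[OF that] mult_nonneg_nonpos[of "\<alpha> U" "s * U (Rho x)"]
        by (simp add: not_less algebra_simps)
      have "(\<Sum>U\<in>S. - s * (\<alpha> U * U (Rho x))) = 0"
        unfolding sum_distrib_left[symmetric] sum0 by simp
      then have "- s * (\<alpha> V * V (Rho x)) = 0"
        by (intro sum_nonneg_0[OF S(1), where f = "\<lambda>U. - s * (\<alpha> U * U (Rho x))"] le V)
      then show False using s nz S(4)[OF V] by auto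
    qed
    obtain V1 where V1: "V1 \<in> S" "color_sign Blue * V1 (Rho x) > 0"
      using pos[of 1] by (auto simp: color_sign_def)
    obtain V2 where V2: "V2 \<in> S" "color_sign Red * V2 (Rho x) > 0"
      using pos[of "-1"] by (auto simp: color_sign_def)
    have red: "d = Red" if "d \<noteq> Blue" for d using that by (cases d) auto
    have blue: "d = Blue" if "d \<noteq> Red" for d using that by (cases d) auto
    obtain p y z d where a: "(p, Red, y) \<in> set C" "(y, d, z) \<in> set C" "d \<noteq> Red"
        "end_level Red y = end_level Red x"
      using turn[OF V2 x] by blast
    obtain p' y' z' d' where b: "(p', Blue, y') \<in> set C" "(y', d', z') \<in> set C" "d' \<noteq> Blue"
        "end_level Blue y' = end_level Blue x"
      using turn[OF V1 x] by blast
    have "x \<in> {1..n}" using cycle_ineq_values(6)[OF S(2)[OF V] nz] .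
    then have "splits n prec (cycle_ineq C)"
      using splits_reroute[OF C(1) a(1) a(2)[unfolded blue[OF a(3)]] b(1) b(2)[unfolded red[OF b(3)]]]
        a(4) b(4) x C(2) by (simp add: end_level_def)
    then show False using ns C(2) by simp
  qed
  have "S \<noteq> {}" using cycle_ineq_nonzero[OF W] W_sum by auto
  then obtain V where V: "V \<in> S" by blast
  note VC = S(2)[OF V]
  \<comment> \<open>The number of arcs of \<open>V\<close> with the color and on the level of an arc
    of \<open>C\<close>.\<close>
  define g where "g = (\<lambda>a. crossing (arc_color a) (end_level (arc_color a) (arc_head a)) V)"
  have "g a = g b" if ab: "a \<in> set C" "b \<in> set C" "arc_head a = fst b" for a b
  proof -
    obtain p c y d z where e: "a = (p, c, y)" "b = (y, d, z)" using ab(3) by (cases a; cases b) auto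
    have z: "start_level d y = end_level d z" using ab(2) cycle_arcs(1)[OF C(1)] arc_iff e by blast
    show ?thesis
    proof (cases "c = d")
      case True
      then have "color_sign c * W (Rho y) > 0"
        using ab(1,2) e unfolding C(2) color_sign_mult_iff[OF C(1)] by blast
      then have "color_sign c * W (Rho y) = 1"
        using cycle_ineq_values(1)[OF W, of y] by (cases c) (auto simp: color_sign_def)
      \<comment> \<open>Tightness at the end level and at the start level of \<open>y\<close>
        equates both counts with the same signed coefficient.\<close>
      from tight[OF this _ V] show ?thesis using z True by (simp add: g_def e)
    next
      case False
      \<comment> \<open>If \<open>W\<close> did not vanish at \<open>x\<close>, then
        \<open>C\<close> would pass \<open>x\<close> in a single color, on a level where the arc
        into or out of \<open>y\<close> is its only arc of that color. So \<open>x = y\<close>,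
        where the color changes.\<close>
      have "V (Rho x) = 0" if x: "x \<in> {1..n}" "end_level c x = end_level c y" for x
      proof (rule zero[OF V])
        have start: "start_level d x = start_level d y"
          using x(2) False by (cases c; cases d) (auto simp: start_level_def end_level_def)
        show "W (Rho x) = 0"
          using W
        proof (cases rule: color_sign_mult_cases[where y = x])
          case (2 c')
          then obtain s t where st: "(s, c', x) \<in> set C" "(x, c', t) \<in> set C"
            using color_sign_mult_iff[OF C(1), of c' x] C(2) by auto
          have t: "start_level c' x = end_level c' t"
            using st(2) cycle_arcs(1)[OF C(1)] arc_iff by blast
          consider "c' = c" | "c' = d" using False by (cases c; cases d; cases c') auto
          then have "x = y"
          proof cases
            case 1
            have "(p, c, y) = (s, c, x)"
              using same_level ab(1) st(1) x(2) unfolding e 1 by metis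
            then show ?thesis by simp
          next
            case 2
            have "(y, d, z) = (x, d, t)"
              using same_level ab(2) st(2) t z start unfolding e 2 by metis
            then show ?thesis by simp
          qed
          have "(s, c', x) = (p, c, y)" "(x, c', t) = (y, d, z)"
            using ab(1,2) st \<open>x = y\<close> unfolding e
            by (intro inj_onD[OF cycle_arcs(3)[OF C(1)]] inj_onD[OF cycle_arcs(4)[OF C(1)]]; simp)+
          then show ?thesis using False by simp
        qed
      qed
      then show ?thesis using crossing_turn[OF False] z by (simp add: g_def e)
    qed
  qed
  then have g_const: "g a = g b" if "a \<in> set C" "b \<in> set C" for a b
    using cycle_constant[OF C(1), of g] that by blast
  obtain e where e: "e \<in> set C" using key_graph_cycle(1)[OF C(1)] by (cases C) auto
  \<comment> \<open>\<open>V\<close> is proportional to \<open>W\<close>; coefficients in {-1, 0, 1}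
    and a nonnegative factor will force the factor 1.\<close>
  have V_W: "V (Rho y) = g e * W (Rho y)" for y
    using W
  proof (cases rule: color_sign_mult_cases[where y = y])
    case 1
    then show ?thesis using zero[OF V] by simp
  next
    case (2 c)
    then obtain p where p: "(p, c, y) \<in> set C"
      using color_sign_mult_iff[OF C(1), of c y] C(2) by auto
    have "g (p, c, y) = color_sign c * V (Rho y)" using tight[OF 2 _ V] by (simp add: g_def)
    then show ?thesis
      using g_const[OF e p] 2 by (cases c) (auto simp: color_sign_def)
  qed
  obtain y where y: "V (Rho y) \<noteq> 0" using cycle_ineq_nonzero[OF VC] by blast
  have "0 \<le> g e" unfolding g_def by (rule crossing_nonneg[OF VC])
  then have "g e = 1"
    using y V_W[of y] cycle_ineq_values(1)[OF VC, of y] cycle_ineq_values(1)[OF W, of y] by auto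
  then have "V = W" using V_W by (intro cycle_ineq_eqI[OF VC W]) simp
  then show False using V S(3) by simp
qed

end

section \<open>Levels from the canonical representation, and the equivalence\<close>

lemma key_levels_exist:
  assumes "interval_order n prec"
  shows "\<exists>l r. key_levels n prec l r"
proof -
  let ?l = "canon_l n prec" and ?r = "canon_r n prec"
  have can: "canonical_rep n prec ?l ?r" using assms by (rule canonical_rep_canon)
  have rep: "?l x \<le> ?r x" "prec x y \<longleftrightarrow> ?r x < ?l y" if "x \<in> {1..n}" "y \<in> {1..n}" for x y
    using can that unfolding canonical_rep_def interval_rep_def by blast+
  have int: "of_int \<lfloor>?l x\<rfloor> = ?l x" "of_int \<lfloor>?r x\<rfloor> = ?r x" if "x \<in> {1..n}" for x
  proof -
    have "?l x \<in> endpoints n ?l ?r" "?r x \<in> endpoints n ?l ?r"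
      using that unfolding endpoints_def by blast+
    moreover have "endpoints n ?l ?r = real ` {..<card (endpoints n ?l ?r)}"
      using can unfolding canonical_rep_def by blast
    ultimately obtain i j where "?l x = real i" "?r x = real j" by (metis imageE)
    then show "of_int \<lfloor>?l x\<rfloor> = ?l x" "of_int \<lfloor>?r x\<rfloor> = ?r x" by simp_all
  qed
  \<comment> \<open>The endpoint equation already implies the order relation:
    \<open>?r x + 1 = ?l y\<close> gives \<open>prec x y\<close>, while \<open>?l x = ?r y\<close>
    makes the intervals meet, so that \<open>x\<close> and \<open>y\<close> are incomparable or
    equal.\<close>
  have arc: "(x, c, y) \<in> arcs (key_graph n prec) \<longleftrightarrow> x \<in> {1..n} \<and> y \<in> {1..n} \<and>
      (case c of Blue \<Rightarrow> ?r x + 1 = ?l y | Red \<Rightarrow> ?l x = ?r y)" for x c y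
  proof (cases "x \<in> {1..n} \<and> y \<in> {1..n}")
    case True
    then show ?thesis
      using rep(1)[of x x] rep(1)[of y y] rep(2)[of x y] rep(2)[of y x]
      by (cases c) (auto simp: key_graph_def slack_zero_def slack_def incomparable_def)
  qed (auto simp: key_graph_def slack_zero_def)
  have "key_levels n prec (\<lambda>x. \<lfloor>?l x\<rfloor>) (\<lambda>x. \<lfloor>?r x\<rfloor>)"
  proof
    show "\<lfloor>?l x\<rfloor> \<le> \<lfloor>?r x\<rfloor>" if "x \<in> {1..n}" for x
      using rep(1)[OF that that] by (rule floor_mono)
    have "?r x + 1 = ?l y \<longleftrightarrow> \<lfloor>?r x\<rfloor> + 1 = \<lfloor>?l y\<rfloor>" "?l x = ?r y \<longleftrightarrow> \<lfloor>?l x\<rfloor> = \<lfloor>?r y\<rfloor>"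
      if "x \<in> {1..n}" "y \<in> {1..n}" for x y
      using int[OF that(1)] int[OF that(2)] by (metis of_int_1 of_int_add of_int_eq_iff)+
    then show "arcs (key_graph n prec) = {(x, c, y). x \<in> {1..n} \<and> y \<in> {1..n} \<and>
        (case c of Blue \<Rightarrow> \<lfloor>?r x\<rfloor> + 1 = \<lfloor>?l y\<rfloor> | Red \<Rightarrow> \<lfloor>?l x\<rfloor> = \<lfloor>?r y\<rfloor>)}"
      by (auto simp: arc split: color.splits)
  qed
  then show ?thesis by blast
qed

theorem theorem5p8:
  fixes n :: nat and prec :: "nat \<Rightarrow> nat \<Rightarrow> bool" and W :: lin_ineq
  assumes "interval_order n prec"
    and "W \<in> cycle_ineqs n prec"
  shows "redundant n prec W \<longleftrightarrow>
    (\<exists>S (c :: lin_ineq \<Rightarrow> nat). finite S \<and> S \<subseteq> {V \<in> cycle_ineqs n prec. smaller V W} \<and>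
       W = (\<lambda>t. \<Sum>V\<in>S. of_nat (c V) * V t))"
proof
  obtain l r where "key_levels n prec l r" using key_levels_exist[OF assms(1)] by blast
  then interpret key_levels n prec l r .
  assume "redundant n prec W"
  then show "\<exists>S (c :: lin_ineq \<Rightarrow> nat). finite S \<and> S \<subseteq> {V \<in> cycle_ineqs n prec. smaller V W} \<and>
      W = (\<lambda>t. \<Sum>V\<in>S. of_nat (c V) * V t)"
    by (intro splits_imp_smaller_combination redundant_imp_splits assms(2))
next
  assume "\<exists>S (c :: lin_ineq \<Rightarrow> nat). finite S \<and> S \<subseteq> {V \<in> cycle_ineqs n prec. smaller V W} \<and>
      W = (\<lambda>t. \<Sum>V\<in>S. of_nat (c V) * V t)"
  then obtain S and c :: "lin_ineq \<Rightarrow> nat" where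
    S: "finite S" "S \<subseteq> {V \<in> cycle_ineqs n prec. smaller V W}"
      "W = (\<lambda>t. \<Sum>V\<in>S. of_nat (c V) * V t)" by blast
  \<comment> \<open>Irreflexivity of the weak order keeps \<open>W\<close> itself out of the
    combination.\<close>
  have "\<not> smaller W W" by (simp add: smaller_def)
  then have "S \<subseteq> {V \<in> cycle_ineqs n prec. V \<noteq> W}" using S(2) by blast
  then show "redundant n prec W"
    unfolding redundant_def
    using S(1,3) by (intro exI[of _ S] exI[of _ "\<lambda>V. of_nat (c V)"]) simp
qed

end
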